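(* Let $\alpha\in(0,1)$ and $\alpha'=\alpha+(1-\alpha)\dfrac{K-1}{K+n}$. Let $S_i^{\mathrm{CV}}$, $i\in[n]$, be the cross-validation scores and $P_k(y)$, $k\in[K]$, the cross-conformal p-value functions built from $K$ folds of equal size $m=n/K$ and a symmetric score function $s$ as defined in the context, and let $U$ be a uniform random variable on $(0,1)$ independent of all the data. Define the cross-conformal prediction set at level $\alpha$, $$\hat C^{\mathrm{cross}}_{n,K,\alpha}(X_{n+1})=\Big\{y\in\mathcal Y:\ \frac{1+\sum_{i=1}^n\mathbf 1\{s((X_{n+1},y);\mathcal D_{[n]\setminus I_{k(i)}})\le S_i^{\mathrm{CV}}\}}{n+1}>\alpha\Big\},$$ and the sets at level $\alpha'$ $$\hat C^{\mathrm{e\text{-}mod\text{-}cross}}_{n,K,\alpha'}(X_{n+1})=\Big\{y\in\mathcal Y:\ \min_{\ell\in[K]}\frac1\ell\sum_{k=1}^{\ell} P_k(y)>\alpha'\Big\},$$ $$\hat C^{\mathrm{u\text{-}mod\text{-}cross}}_{n,K,\alpha'}(X_{n+1})=\Big\{y\in\mathcal Y:\ \frac{1}{2-U}\,\frac1K\sum_{k=1}^{K} P_k(y)>\alpha'\Big\},$$ $$\hat C^{\mathrm{eu\text{-}mod\text{-}cross}}_{n,K,\alpha'}(X_{n+1})=\Big\{y\in\mathcal Y:\ \min\Big\{\frac{1}{2-U}P_1(y),\ \min_{\ell\in[K]}\frac1\ell\sum_{k=1}^{\ell} P_k(y)\Big\}>\alpha'\Big\}.$$ Then $$\hat C^{\mathrm{e\text{-}mod\text{-}cross}}_{n,K,\alpha'}(X_{n+1})\subseteq\hat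 C^{\mathrm{cross}}_{n,K,\alpha}(X_{n+1}),\qquad \hat C^{\mathrm{u\text{-}mod\text{-}cross}}_{n,K,\alpha'}(X_{n+1})\subseteq\hat C^{\mathrm{cross}}_{n,K,\alpha}(X_{n+1}),$$ $$\hat C^{\mathrm{eu\text{-}mod\text{-}cross}}_{n,K,\alpha'}(X_{n+1})\subseteq\hat C^{\mathrm{e\text{-}mod\text{-}cross}}_{n,K,\alpha'}(X_{n+1})\subseteq\hat C^{\mathrm{cross}}_{n,K,\alpha}(X_{n+1}).$$ Moreover, if the data $(X_1,Y_1),\dots,(X_{n+1},Y_{n+1})$ are exchangeable, then each of the three sets $\hat C=\hat C^{\mathrm{e\text{-}mod\text{-}cross}}_{n,K,\alpha'}(X_{n+1})$, $\hat C^{\mathrm{u\text{-}mod\text{-}cross}}_{n,K,\alpha'}(X_{n+1})$, $\hat C^{\mathrm{eu\text{-}mod\text{-}cross}}_{n,K,\alpha'}(X_{n+1})$ has marginal coverage $\mathbb P(Y_{n+1}\in\hat C)\ge 1-2\alpha'$.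
   Context: Write $[d]=\{1,\dots,d\}$. Data points $Z_i=(X_i,Y_i)$, $i\in[n+1]$, are random elements of $\mathcal X\times\mathcal Y$ (measurable spaces); the first $n$ are training points and $(X_{n+1},Y_{n+1})$ is the test point. For $I\subseteq[n]$ let $\mathcal D_I=(Z_i: i\in I)$. Score function: $s((x,y);\mathcal D)\in\mathbb R$ is a (measurable) function defined for $(x,y)\in\mathcal X\times\mathcal Y$ and any finite dataset $\mathcal D\in\bigcup_{d\ge1}(\mathcal X\times\mathcal Y)^d$, and it is symmetric in the dataset: $s((x,y);\mathcal D)=s((x,y);\mathcal D^\pi)$ for every $\mathcal D\in(\mathcal X\times\mathcal Y)^d$ and every permutation $\pi$ of $[d]$, where $\mathcal D^\pi$ is $\mathcal D$ with its elements permuted by $\pi$. Folds: $[n]$ is partitioned into $K\ge2$ disjoint folds $I_1,\dots,I_K$ (chosen independently of the data), each of size $m=n/K$, which is assumed to be an integer. For $i\in[n]$, $k(i)$ is the index of the fold containing $i$, and $S_i^{\mathrm{CV}}=s\big((X_i,Y_i);\mathcal D_{[n]\setminus I_{k(i)}}\big)$. Cross-conformal p-values: for $k\in[K]$ and $y\in\mathcal Y$, $$P_k(y)=\frac{1+\sum_{i\in I_k}\mathbf 1\{s((X_{n+1},y);\mathcal D_{[n]\setminus I_k})\le S_i^{\mathrm{CV}}\}}{m+1}.$$ Exchangeable means that the joint distribution is invariant under every permutation of the indices. Probabilities are over all data $(X_1,Y_1),\dots,(X_{n+1},Y_{n+1})$ and $U$ (which is independent of the data and the folds). *)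

theory Defs
  imports "HOL-Probability.Probability" "HOL-Combinatorics.Combinatorics"
begin

text \<open>
  A data point is a pair \<open>z = (x, y)\<close>, and a dataset is a nonempty list of data points.
  In the definitions below \<open>N\<close> is the measurable space of data points.
\<close>

definition measurable_score :: "'z measure \<Rightarrow> ('z \<Rightarrow> 'z list \<Rightarrow> real) \<Rightarrow> bool" where
  "measurable_score N s \<longleftrightarrow>
     (\<forall>d\<ge>1. (\<lambda>(z, D). s z (map D [0..<d])) \<in> borel_measurable (N \<Otimes>\<^sub>M (\<Pi>\<^sub>M j\<in>{..<d}. N)))"

definition symmetric_score :: "'z measure \<Rightarrow> ('z \<Rightarrow> 'z list \<Rightarrow> real) \<Rightarrow> bool" where
  "symmetric_score N s \<longleftrightarrow>
     (\<forall>z\<in>space N. \<forall>D\<in>lists (space N). D \<noteq> [] \<longrightarrow>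
        (\<forall>\<pi>. \<pi> permutes {..<length D} \<longrightarrow> s z (permute_list \<pi> D) = s z D))"

text \<open>
  The sub-dataset with indices in \<open>J\<close>, listed by increasing index
  (the order is immaterial for a symmetric score).
\<close>

definition subdata :: "(nat \<Rightarrow> 'z) \<Rightarrow> nat set \<Rightarrow> 'z list" where
  "subdata z J = map z (sorted_list_of_set J)"

text \<open>
  Fold systems are functions \<open>I\<close> with folds \<open>I 1, \<dots>, I K\<close>. They are made extensional
  outside \<open>{1..K}\<close>, so that \<open>fold_systems n K\<close> is a finite set and random folds can be treated
  as random elements of the discrete space on it.
\<close>

definition fold_systems :: "nat \<Rightarrow> nat \<Rightarrow> (nat \<Rightarrow> nat set) set" where
  "fold_systems n K =
     {I \<in> {1..K} \<rightarrow>\<^sub>E Pow {1..n}.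
        (\<Union>k\<in>{1..K}. I k) = {1..n} \<and> disjoint_family_on I {1..K} \<and>
        (\<forall>k\<in>{1..K}. card (I k) = n div K)}"

definition fold_index :: "nat \<Rightarrow> (nat \<Rightarrow> nat set) \<Rightarrow> nat \<Rightarrow> nat" where
  "fold_index K I i = (THE k. k \<in> {1..K} \<and> i \<in> I k)"

text \<open>
  Here \<open>z 1, \<dots>, z n\<close> are the training points, \<open>x\<close> is the test feature, \<open>I\<close> is the fold system
  and \<open>V\<close> is the label space.
\<close>

definition cv_score ::
  "('x \<times> 'y \<Rightarrow> ('x \<times> 'y) list \<Rightarrow> real) \<Rightarrow> nat \<Rightarrow> nat \<Rightarrow> (nat \<Rightarrow> nat set) \<Rightarrow>
   (nat \<Rightarrow> 'x \<times> 'y) \<Rightarrow> nat \<Rightarrow> real" where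
  "cv_score s n K I z i = s (z i) (subdata z ({1..n} - I (fold_index K I i)))"

definition cross_pvalue ::
  "('x \<times> 'y \<Rightarrow> ('x \<times> 'y) list \<Rightarrow> real) \<Rightarrow> nat \<Rightarrow> nat \<Rightarrow> (nat \<Rightarrow> nat set) \<Rightarrow>
   (nat \<Rightarrow> 'x \<times> 'y) \<Rightarrow> 'x \<Rightarrow> nat \<Rightarrow> 'y \<Rightarrow> real" where
  "cross_pvalue s n K I z x k y =
     (1 + (\<Sum>i\<in>I k. of_bool (s (x, y) (subdata z ({1..n} - I k)) \<le> cv_score s n K I z i))) /
     (real (n div K) + 1)"

definition cross_set ::
  "'y set \<Rightarrow> ('x \<times> 'y \<Rightarrow> ('x \<times> 'y) list \<Rightarrow> real) \<Rightarrow> nat \<Rightarrow> nat \<Rightarrow> (nat \<Rightarrow> nat set) \<Rightarrow> real \<Rightarrow>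
   (nat \<Rightarrow> 'x \<times> 'y) \<Rightarrow> 'x \<Rightarrow> 'y set" where
  "cross_set V s n K I a z x =
     {y \<in> V. (1 + (\<Sum>i=1..n. of_bool (s (x, y) (subdata z ({1..n} - I (fold_index K I i)))
                                        \<le> cv_score s n K I z i))) / (real n + 1) > a}"

definition e_mod_cross_set ::
  "'y set \<Rightarrow> ('x \<times> 'y \<Rightarrow> ('x \<times> 'y) list \<Rightarrow> real) \<Rightarrow> nat \<Rightarrow> nat \<Rightarrow> (nat \<Rightarrow> nat set) \<Rightarrow> real \<Rightarrow>
   (nat \<Rightarrow> 'x \<times> 'y) \<Rightarrow> 'x \<Rightarrow> 'y set" where
  "e_mod_cross_set V s n K I a z x =
     {y \<in> V. (MIN l\<in>{1..K}. 1 / real l * (\<Sum>k=1..l. cross_pvalue s n K I z x k y)) > a}"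

definition u_mod_cross_set ::
  "'y set \<Rightarrow> ('x \<times> 'y \<Rightarrow> ('x \<times> 'y) list \<Rightarrow> real) \<Rightarrow> nat \<Rightarrow> nat \<Rightarrow> (nat \<Rightarrow> nat set) \<Rightarrow> real \<Rightarrow>
   real \<Rightarrow> (nat \<Rightarrow> 'x \<times> 'y) \<Rightarrow> 'x \<Rightarrow> 'y set" where
  "u_mod_cross_set V s n K I a u z x =
     {y \<in> V. 1 / (2 - u) * (1 / real K * (\<Sum>k=1..K. cross_pvalue s n K I z x k y)) > a}"

definition eu_mod_cross_set ::
  "'y set \<Rightarrow> ('x \<times> 'y \<Rightarrow> ('x \<times> 'y) list \<Rightarrow> real) \<Rightarrow> nat \<Rightarrow> nat \<Rightarrow> (nat \<Rightarrow> nat set) \<Rightarrow> real \<Rightarrow>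
   real \<Rightarrow> (nat \<Rightarrow> 'x \<times> 'y) \<Rightarrow> 'x \<Rightarrow> 'y set" where
  "eu_mod_cross_set V s n K I a u z x =
     {y \<in> V. min (1 / (2 - u) * cross_pvalue s n K I z x 1 y)
                 (MIN l\<in>{1..K}. 1 / real l * (\<Sum>k=1..l. cross_pvalue s n K I z x k y)) > a}"

definition data_vector :: "nat set \<Rightarrow> (nat \<Rightarrow> 'w \<Rightarrow> 'z) \<Rightarrow> 'w \<Rightarrow> nat \<Rightarrow> 'z" where
  "data_vector J Z \<omega> = (\<lambda>j\<in>J. Z j \<omega>)"

definition exchangeable :: "'w measure \<Rightarrow> 'z measure \<Rightarrow> nat set \<Rightarrow> (nat \<Rightarrow> 'w \<Rightarrow> 'z) \<Rightarrow> bool" where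
  "exchangeable M N J Z \<longleftrightarrow>
     (\<forall>\<pi>. \<pi> permutes J \<longrightarrow>
        distr M (\<Pi>\<^sub>M j\<in>J. N) (data_vector J (\<lambda>j. Z (\<pi> j))) =
        distr M (\<Pi>\<^sub>M j\<in>J. N) (data_vector J Z))"

text \<open>
  \<open>prob_space.indep_var\<close> requires both random variables to have the same value type; this is
  independence of the generated sigma-algebras for arbitrary value types.
\<close>

definition indep_rv ::
  "'w measure \<Rightarrow> 'a measure \<Rightarrow> ('w \<Rightarrow> 'a) \<Rightarrow> 'b measure \<Rightarrow> ('w \<Rightarrow> 'b) \<Rightarrow> bool" where
  "indep_rv M S A T B \<longleftrightarrow>
     prob_space.indep_set M {A -` C \<inter> space M | C. C \<in> sets S} {B -` C \<inter> space M | C. C \<in> sets T}"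

end

theory Submission
  imports Defs
begin

text \<open>
  The inclusions hold because the average of all \<open>P\<^sub>k\<close> equals the cross-conformal count
  shifted by \<open>K - 1\<close>, and \<open>\<alpha>'\<close> absorbs the shift.

  For coverage, put \<open>a = \<alpha>'\<close> and \<open>X\<^sub>k = max 0 (2 - P\<^sub>k / a)\<close>. A p-value satisfies
  \<open>E X\<^sub>k \<le> 2 a\<close>, and an average of p-values that is at most \<open>a\<close> (or \<open>(2 - u) a\<close>) makes the
  corresponding average of the \<open>X\<^sub>k\<close> at least \<open>1\<close> (or \<open>u\<close>). Miscoverage therefore forces
  \<open>u \<le> H\<close>, where \<open>H\<close> is the full average of the \<open>X\<^sub>k\<close> for the u-set, and their running average
  at the last time it reaches \<open>1\<close> (time \<open>1\<close> if there is none) for the eu-set. As \<open>U\<close> is uniform,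
  the miscoverage probability is at most \<open>E H\<close>. For fixed data and folds, the mean of \<open>H\<close> over all
  permutations of the data points is at most \<open>2 a\<close>: transposing the test point with a point of a
  fold gives validity of \<open>P\<^sub>k\<close>, and exchanging two folds gives exchangeability of the \<open>X\<^sub>k\<close>.
  Exchangeability of the data turns this deterministic bound into \<open>E H \<le> 2 a\<close>.
\<close>

subsection \<open>Ranks and the calibrator\<close>

text \<open>Ties count in full and, for \<open>t \<in> T\<close>, so does \<open>t\<close> itself.
  For the test point within its fold this is the numerator of a conformal p-value.\<close>

definition rank_count :: "('i \<Rightarrow> real) \<Rightarrow> 'i set \<Rightarrow> 'i \<Rightarrow> nat" where
  "rank_count c T t = card {i \<in> T. c t \<le> c i}"

lemma rank_count_permute:
  assumes "inj_on \<rho> T" "t \<in> T" "\<And>i. i \<in> T \<Longrightarrow> c i = c' (\<rho> i)"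
  shows "rank_count c T t = rank_count c' (\<rho> ` T) (\<rho> t)"
proof -
  have "{i \<in> \<rho> ` T. c' (\<rho> t) \<le> c' i} = \<rho> ` {i \<in> T. c t \<le> c i}"
    using assms(2,3) by auto
  moreover have "inj_on \<rho> {i \<in> T. c t \<le> c i}"
    using assms(1) by (rule inj_on_subset) auto
  ultimately show ?thesis by (simp add: rank_count_def card_image)
qed

text \<open>Without ties the ranks run through \<open>1..card T\<close> exactly once; ties only
  raise ranks, and \<open>g\<close> is antitone. The induction removes an element of least score,
  whose rank is \<open>card T\<close>.\<close>

lemma sum_rank_count_le:
  fixes g :: "nat \<Rightarrow> real"
  assumes "finite T" and "antimono g"
  shows "(\<Sum>t\<in>T. g (rank_count c T t)) \<le> (\<Sum>r=1..card T. g r)"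
  using assms(1)
proof (induction "card T" arbitrary: T)
  case 0
  then show ?case by simp
next
  case (Suc N)
  then have "T \<noteq> {}" by auto
  then obtain t where t: "t \<in> T" "\<And>i. i \<in> T \<Longrightarrow> c t \<le> c i"
    using arg_min_if_finite[OF Suc.prems, of c] by (metis not_less)
  let ?T = "T - {t}"
  have card: "card ?T = N" using Suc.hyps(2) Suc.prems t(1) by simp
  have top: "rank_count c T t = Suc N"
  proof -
    have "{i \<in> T. c t \<le> c i} = T" using t by auto
    then show ?thesis using Suc.hyps(2) by (simp add: rank_count_def)
  qed
  have mono: "g (rank_count c T i) \<le> g (rank_count c ?T i)" for i
    using Suc.prems by (intro antimonoD[OF assms(2)]) (auto simp: rank_count_def intro!: card_mono)
  have "(\<Sum>i\<in>T. g (rank_count c T i)) = g (Suc N) + (\<Sum>i\<in>?T. g (rank_count c T i))"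
    using Suc.prems t(1) top by (simp add: sum.remove)
  also have "\<dots> \<le> g (Suc N) + (\<Sum>i\<in>?T. g (rank_count c ?T i))"
    using mono by (intro add_left_mono sum_mono)
  also have "\<dots> \<le> g (Suc N) + (\<Sum>r=1..N. g r)"
    using Suc.hyps(1)[of ?T] card Suc.prems by simp
  also have "\<dots> = (\<Sum>r=1..card T. g r)"
    using Suc.hyps(2)[symmetric] by simp
  finally show ?case .
qed

text \<open>For \<open>a > 0\<close> a p-to-e calibrator up to scale: convex and antitone,
  \<open>1\<close> at \<open>p = a\<close>, \<open>0\<close> from \<open>p = 2 * a\<close> on, with
  area \<open>2 * a\<close> over \<open>p \<ge> 0\<close>. Convexity carries it through averages of
  p-values.\<close>

definition calibrator :: "real \<Rightarrow> real \<Rightarrow> real" where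
  "calibrator a p = max 0 (2 - p / a)"

lemma calibrator_nonneg: "0 \<le> calibrator a p"
  by (simp add: calibrator_def)

text \<open>A right-endpoint Riemann sum of an antitone function is at most the area under
  it.\<close>

lemma sum_calibrator_le:
  assumes "0 < x"
  shows "(\<Sum>r=1..N. calibrator x (real r)) \<le> 2 * x"
proof -
  \<comment> \<open>The subtracted term is the area beyond \<open>N\<close>; it makes the bound
    inductive.\<close>
  have "(\<Sum>r=1..N. calibrator x (real r)) \<le> 2 * x - (max 0 (2 * x - real N))\<^sup>2 / (2 * x)"
  proof (induction N)
    case 0
    then show ?case using assms by (simp add: power2_eq_square)
  next
    case (Suc N)
    let ?b = "2 * x - real (Suc N)"
    \<comment> \<open>The right side is the area of the strip from \<open>N\<close> to
      \<open>Suc N\<close>.\<close>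
    have "calibrator x (real (Suc N)) \<le> ((max 0 (?b + 1))\<^sup>2 - (max 0 ?b)\<^sup>2) / (2 * x)"
    proof (cases "0 \<le> ?b")
      case True
      then have "calibrator x (real (Suc N)) = (2 * ?b) / (2 * x)"
        using assms by (simp add: calibrator_def field_simps max_def)
      also have "\<dots> \<le> ((max 0 (?b + 1))\<^sup>2 - (max 0 ?b)\<^sup>2) / (2 * x)"
        using True assms by (intro divide_right_mono) (simp_all add: max_def power2_eq_square algebra_simps)
      finally show ?thesis .
    next
      case False
      then have "calibrator x (real (Suc N)) = 0"
        using assms by (simp add: calibrator_def field_simps max_def)
      then show ?thesis using False assms by (simp add: max_def)
    qed
    with Suc show ?case by (simp add: diff_divide_distrib algebra_simps)
  qed
  also have "\<dots> \<le> 2 * x" using assms by simp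
  finally show ?thesis .
qed

text \<open>Scaling \<open>a\<close> by \<open>card T\<close> turns rank fractions into integer
  ranks, to which the two preceding bounds apply. This is the validity of conformal p-values in
  summed form.\<close>

lemma sum_calibrator_rank_le:
  assumes "finite T" "0 < a"
  shows "(\<Sum>t\<in>T. calibrator a (real (rank_count c T t) / real (card T))) \<le> 2 * a * real (card T)"
proof (cases "T = {}")
  case False
  with assms have pos: "0 < real (card T)" by (simp add: card_gt_0_iff)
  have *: "calibrator a (r / real (card T)) = calibrator (a * real (card T)) r" for r
    by (simp add: calibrator_def mult.commute)
  have "antimono (\<lambda>r. calibrator (a * real (card T)) (real r))"
    unfolding calibrator_def using assms(2)
    by (intro antimonoI max.mono diff_left_mono divide_right_mono) auto
  from order_trans[OF sum_rank_count_le[OF assms(1) this] sum_calibrator_le]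
  show ?thesis using pos assms(2) by (simp add: * mult.assoc)
qed simp

subsection \<open>Running averages\<close>

definition run_avg :: "(nat \<Rightarrow> real) \<Rightarrow> nat \<Rightarrow> real" where
  "run_avg X l = 1 / real l * (\<Sum>k=1..l. X k)"

lemma run_avg_nonneg: "(\<And>k. 0 \<le> X k) \<Longrightarrow> 0 \<le> run_avg X l"
  by (simp add: run_avg_def sum_nonneg)

text \<open>Truncation at \<open>0\<close> only raises the affine map \<open>2 - p / a\<close>, and
  affine maps commute with averaging.\<close>

lemma run_avg_calibrator_ge:
  assumes "1 \<le> l"
  shows "2 - run_avg p l / a \<le> run_avg (\<lambda>k. calibrator a (p k)) l"
proof -
  have "2 - run_avg p l / a = 1 / real l * (\<Sum>k=1..l. 2 - p k / a)"
    using assms by (simp add: run_avg_def sum_subtractf right_diff_distrib flip: sum_divide_distrib)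
  also have "\<dots> \<le> 1 / real l * (\<Sum>k=1..l. calibrator a (p k))"
    by (intro mult_left_mono sum_mono) (simp_all add: calibrator_def)
  finally show ?thesis by (simp add: run_avg_def)
qed

text \<open>The disjunct \<open>l = 1\<close> makes the set nonempty for \<open>K \<ge> 1\<close>
  and supplies the default time \<open>1\<close>. Read from \<open>K\<close> downwards, this is a
  stopping time for the reversed sequence of averages.\<close>

definition last_crossing :: "nat \<Rightarrow> (nat \<Rightarrow> real) \<Rightarrow> nat" where
  "last_crossing K X = Max {l \<in> {1..K}. l = 1 \<or> 1 \<le> run_avg X l}"

lemma last_crossing_eq_iff:
  assumes "1 \<le> K"
  shows "last_crossing K X = l \<longleftrightarrow>
    l \<in> {1..K} \<and> (l = 1 \<or> 1 \<le> run_avg X l) \<and> (\<forall>l'\<in>{l<..K}. run_avg X l' < 1)"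
proof -
  let ?A = "{l \<in> {1..K}. l = 1 \<or> 1 \<le> run_avg X l}"
  have "1 \<in> ?A" using assms by simp
  then have "?A \<noteq> {}" by blast
  then have "Max ?A = l \<longleftrightarrow> l \<in> ?A \<and> (\<forall>l'\<in>?A. l' \<le> l)"
    by (intro Max_eq_iff) auto
  moreover have "(\<forall>l'\<in>?A. l' \<le> l) \<longleftrightarrow> (\<forall>l'\<in>{l<..K}. run_avg X l' < 1)" if "1 \<le> l"
  proof (intro iffI ballI)
    fix l' assume *: "\<forall>l'\<in>?A. l' \<le> l" "l' \<in> {l<..K}"
    then have "l' \<notin> ?A" by (meson greaterThanAtMost_iff leD)
    with *(2) show "run_avg X l' < 1" by simp
  next
    fix l' assume *: "\<forall>l'\<in>{l<..K}. run_avg X l' < 1" "l' \<in> ?A"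
    show "l' \<le> l"
    proof (rule ccontr)
      assume "\<not> l' \<le> l"
      with *(2) have "l' \<in> {l<..K}" by simp
      with *(1) have "run_avg X l' < 1" by blast
      with *(2) \<open>\<not> l' \<le> l\<close> that show False by simp
    qed
  qed
  ultimately show ?thesis
    unfolding last_crossing_def by (cases "1 \<le> l") simp_all
qed

lemma run_avg_transpose:
  assumes "j \<in> {1..l}"
  shows "run_avg (\<lambda>k. X (Transposition.transpose 1 j k)) l = run_avg X l"
proof -
  have "Transposition.transpose 1 j permutes {1..l}"
    using assms by (intro permutes_swap_id) auto
  then have "(\<Sum>k=1..l. X (Transposition.transpose 1 j k)) = (\<Sum>k=1..l. X k)"
    by (rule sum.permute[unfolded comp_def, symmetric])
  then show ?thesis by (simp add: run_avg_def)
qed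

text \<open>
  Exchangeable Markov inequality: the event \<open>last_crossing = l\<close> depends only on
  \<open>run_avg l, \<dots>, run_avg K\<close>, so it is invariant under exchanging \<open>X 1\<close> with any \<open>X j\<close>,
  \<open>j \<le> l\<close>. This is optional stopping for the reverse martingale of running averages.
\<close>

lemma sum_run_avg_last_crossing:
  fixes X :: "'g \<Rightarrow> nat \<Rightarrow> real"
  assumes "finite G" "1 \<le> K"
    and \<Phi>: "\<And>j. j \<in> {1..K} \<Longrightarrow> \<Phi> j ` G \<subseteq> G" "\<And>j. j \<in> {1..K} \<Longrightarrow> inj_on (\<Phi> j) G"
    and exch: "\<And>g j k. \<lbrakk>g \<in> G; j \<in> {1..K}; k \<in> {1..K}\<rbrakk> \<Longrightarrow>
                  X (\<Phi> j g) k = X g (Transposition.transpose 1 j k)"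
  shows "(\<Sum>g\<in>G. run_avg (X g) (last_crossing K (X g))) = (\<Sum>g\<in>G. X g 1)"
proof -
  let ?G = "\<lambda>l. {g \<in> G. last_crossing K (X g) = l}"
  have avg: "run_avg (X (\<Phi> j g)) l = run_avg (X g) l"
    if "g \<in> G" "j \<in> {1..l}" "l \<le> K" for g j l
  proof -
    have "run_avg (X (\<Phi> j g)) l = run_avg (\<lambda>k. X g (Transposition.transpose 1 j k)) l"
      using that exch unfolding run_avg_def by (intro arg_cong2[where f="(*)"] sum.cong) auto
    also have "\<dots> = run_avg (X g) l" by (rule run_avg_transpose[OF that(2)])
    finally show ?thesis .
  qed
  \<comment> \<open>\<open>\<Phi> j\<close> permutes the level set and carries coordinate
    \<open>1\<close> to coordinate \<open>j\<close>, so all coordinates up to \<open>l\<close> have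
    the same sum on it.\<close>
  have swap: "(\<Sum>g\<in>?G l. X g j) = (\<Sum>g\<in>?G l. X g 1)" if l: "l \<le> K" and j: "j \<in> {1..l}" for l j
  proof -
    have jK: "j \<in> {1..K}" using l j by auto
    have inj: "inj_on (\<Phi> j) (?G l)" using \<Phi>(2)[OF jK] by (rule inj_on_subset) auto
    have "\<Phi> j ` ?G l \<subseteq> ?G l"
    proof
      fix g' assume "g' \<in> \<Phi> j ` ?G l"
      then obtain g where g: "g' = \<Phi> j g" "g \<in> G" "last_crossing K (X g) = l" by auto
      \<comment> \<open>The averages from \<open>l\<close> to \<open>K\<close> decide whether the
        crossing time is \<open>l\<close>.\<close>
      have "run_avg (X g') l' = run_avg (X g) l'" if "l' \<in> {l..K}" for l'
        using that avg[of g j l'] g j by auto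
      then have "last_crossing K (X g') = l"
        using g(3) unfolding last_crossing_eq_iff[OF assms(2)] by simp
      then show "g' \<in> ?G l" using g \<Phi>(1)[OF jK] by auto
    qed
    \<comment> \<open>An injective self-map of a finite set is onto.\<close>
    then have surj: "\<Phi> j ` ?G l = ?G l"
      using inj assms(1) by (intro endo_inj_surj) auto
    have "(\<Sum>g\<in>?G l. X g 1) = (\<Sum>g\<in>\<Phi> j ` ?G l. X g 1)" by (simp add: surj)
    also have "\<dots> = (\<Sum>g\<in>?G l. X (\<Phi> j g) 1)" by (simp add: sum.reindex[OF inj])
    also have "\<dots> = (\<Sum>g\<in>?G l. X g j)" using exch jK assms(2) by (intro sum.cong) auto
    finally show ?thesis by simp
  qed
  have level: "(\<Sum>g\<in>?G l. run_avg (X g) l) = (\<Sum>g\<in>?G l. X g 1)" if l: "l \<in> {1..K}" for l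
  proof -
    have "(\<Sum>g\<in>?G l. run_avg (X g) l) = 1 / real l * (\<Sum>j=1..l. \<Sum>g\<in>?G l. X g j)"
      unfolding run_avg_def sum_distrib_left[symmetric] by (subst sum.swap) simp
    also have "\<dots> = 1 / real l * (\<Sum>j=1..l. \<Sum>g\<in>?G l. X g 1)"
      by (rule arg_cong2[OF refl], rule sum.cong[OF refl], rule swap) (use l in auto)
    also have "\<dots> = (\<Sum>g\<in>?G l. X g 1)" using l by simp
    finally show ?thesis .
  qed
  have range: "(\<lambda>g. last_crossing K (X g)) ` G \<subseteq> {1..K}"
    using last_crossing_eq_iff[OF assms(2), THEN iffD1, OF refl] by blast
  have "(\<Sum>g\<in>G. run_avg (X g) (last_crossing K (X g)))
      = (\<Sum>l\<in>{1..K}. \<Sum>g\<in>?G l. run_avg (X g) (last_crossing K (X g)))"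
    by (rule sum.group[symmetric]) (use assms range in auto)
  also have "\<dots> = (\<Sum>l\<in>{1..K}. \<Sum>g\<in>?G l. run_avg (X g) l)"
    by (intro sum.cong) auto
  also have "\<dots> = (\<Sum>l\<in>{1..K}. \<Sum>g\<in>?G l. X g 1)"
    by (rule sum.cong[OF refl], rule level)
  also have "\<dots> = (\<Sum>g\<in>G. X g 1)"
    by (rule sum.group) (use assms range in auto)
  finally show ?thesis .
qed

text \<open>If some calibrated average reaches \<open>1\<close>, the average at the crossing time is
  at least \<open>1 > u\<close>. Otherwise every average of \<open>p\<close> exceeds
  \<open>a\<close>, the time defaults to \<open>1\<close>, and the failure must come from the
  randomized bound on \<open>p 1\<close>.\<close>

lemma u_le_run_avg_last_crossing:
  assumes "1 \<le> K" "0 < a" and u: "0 < u" "u < 1"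
    and bad: "min (1 / (2 - u) * p 1) (MIN l\<in>{1..K}. run_avg p l) \<le> a"
  defines "X \<equiv> \<lambda>k. calibrator a (p k)"
  shows "u \<le> run_avg X (last_crossing K X)"
proof -
  let ?t = "last_crossing K X"
  from last_crossing_eq_iff[OF assms(1), of X ?t]
  have t: "?t \<in> {1..K}" "?t = 1 \<or> 1 \<le> run_avg X ?t" "\<And>l. l \<in> {?t<..K} \<Longrightarrow> run_avg X l < 1"
    by auto
  show ?thesis
  proof (cases "1 \<le> run_avg X ?t")
    case True
    then show ?thesis using u by simp
  next
    case False
    then have t1: "?t = 1" using t(2) by blast
    have "run_avg X l < 1" if "l \<in> {1..K}" for l
      using t(3)[of l] t1 False that by (cases "l = 1") auto
    \<comment> \<open>An average of p-values at or below \<open>a\<close> makes the affine lower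
      bound at least \<open>1\<close>.\<close>
    moreover have "1 \<le> run_avg X l" if "l \<in> {1..K}" "run_avg p l \<le> a" for l
    proof -
      have "run_avg p l / a \<le> 1" using that assms(2) by simp
      then show ?thesis
        using run_avg_calibrator_ge[of l p a] that unfolding X_def by simp
    qed
    ultimately have "a < run_avg p l" if "l \<in> {1..K}" for l
      using that by (meson not_le)
    then have "a < (MIN l\<in>{1..K}. run_avg p l)"
      using assms(1) by (subst Min_gr_iff) auto
    with bad have "1 / (2 - u) * p 1 \<le> a" by (simp add: min_le_iff_disj)
    then have "u \<le> 2 - p 1 / a" using u assms(2) by (simp add: field_simps)
    also have "\<dots> \<le> X 1" by (simp add: X_def calibrator_def)
    also have "\<dots> = run_avg X ?t" unfolding t1 by (simp add: run_avg_def)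
    finally show ?thesis .
  qed
qed

lemma u_le_run_avg:
  assumes "1 \<le> K" "0 < a" "u < 1" "1 / (2 - u) * run_avg p K \<le> a"
  shows "u \<le> run_avg (\<lambda>k. calibrator a (p k)) K"
proof -
  have "u \<le> 2 - run_avg p K / a" using assms by (simp add: field_simps)
  also have "\<dots> \<le> run_avg (\<lambda>k. calibrator a (p k)) K" by (rule run_avg_calibrator_ge[OF assms(1)])
  finally show ?thesis .
qed

subsection \<open>Permuting the data points\<close>

lemma mset_subdata:
  "finite J \<Longrightarrow> mset (subdata z J) = image_mset z (mset_set J)"
  using mset_set_set[OF distinct_sorted_list_of_set, of J] by (simp add: subdata_def)

text \<open>Lists with equal multisets differ by a \<open>permute_list\<close>, so a symmetric score
  sees only the multiset of its dataset.\<close>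

lemma symmetric_score_mset_cong:
  assumes "symmetric_score N s" "z \<in> space N" "set D \<subseteq> space N" "D \<noteq> []" "mset D' = mset D"
  shows "s z D' = s z D"
proof -
  obtain \<pi> where "\<pi> permutes {..<length D}" "permute_list \<pi> D = D'"
    using mset_eq_permutation[OF assms(5)] by blast
  then show ?thesis using assms by (auto simp: symmetric_score_def in_lists_conv_set)
qed

text \<open>The scored point is given by its index, so that the test index \<open>n + 1\<close> and
  training indices are treated alike and permutations act on both.\<close>

definition score_at :: "('z \<Rightarrow> 'z list \<Rightarrow> real) \<Rightarrow> nat set \<Rightarrow> (nat \<Rightarrow> 'z) \<Rightarrow> nat \<Rightarrow> real" where
  "score_at s J z j = s (z j) (subdata z J)"

text \<open>The sorted listing of \<open>J\<close> and that of its image give the data points in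
  different orders but with the same multiset, and symmetry of the score absorbs the
  difference.\<close>

lemma score_at_permute:
  assumes "symmetric_score N s" "finite A" "\<rho> permutes A" "J \<subseteq> A" "J \<noteq> {}" "j \<in> A"
    and "\<And>i. i \<in> A \<Longrightarrow> z i \<in> space N"
  shows "score_at s J (z \<circ> \<rho>) j = score_at s (\<rho> ` J) z (\<rho> j)"
proof -
  have fin: "finite J" using assms(2,4) by (rule finite_subset[rotated])
  have inj: "inj_on \<rho> J" using assms(3) by (meson inj_on_subset permutes_inj subset_UNIV)
  have im: "\<rho> ` J \<subseteq> A" using assms(3,4) by (metis image_mono permutes_image)
  have "mset (subdata (z \<circ> \<rho>) J) = mset (subdata z (\<rho> ` J))"
    unfolding mset_subdata[OF fin] mset_subdata[OF finite_imageI[OF fin]]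
      image_mset_mset_set[OF inj, symmetric] multiset.map_comp ..
  moreover have "set (subdata z (\<rho> ` J)) \<subseteq> space N"
    using fin im assms(7) unfolding subdata_def set_map by (subst set_sorted_list_of_set) blast+
  moreover have "subdata z (\<rho> ` J) \<noteq> []"
    using fin assms(5) by (simp add: subdata_def)
  moreover have "z (\<rho> j) \<in> space N"
    using assms(3,6,7) by (metis permutes_in_image)
  ultimately show ?thesis
    unfolding score_at_def comp_apply by (intro symmetric_score_mset_cong[OF assms(1)])
qed

text \<open>The p-value at the true test label, written as a function of one data vector so that
  permutations of all \<open>n + 1\<close> points act on it.\<close>

definition test_pvalue ::
  "('x \<times> 'y \<Rightarrow> ('x \<times> 'y) list \<Rightarrow> real) \<Rightarrow> nat \<Rightarrow> nat \<Rightarrow> (nat \<Rightarrow> nat set) \<Rightarrow>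
   (nat \<Rightarrow> 'x \<times> 'y) \<Rightarrow> nat \<Rightarrow> real" where
  "test_pvalue s n K I z k = cross_pvalue s n K I z (fst (z (n + 1))) k (snd (z (n + 1)))"

section \<open>Combinatorics of a fixed fold system\<close>

context
  fixes n K :: nat and I :: "nat \<Rightarrow> nat set"
  assumes I: "I \<in> fold_systems n K"
begin

lemma fold_subset: "k \<in> {1..K} \<Longrightarrow> I k \<subseteq> {1..n}"
  using I by (auto simp: fold_systems_def PiE_iff)

lemma fold_finite: "k \<in> {1..K} \<Longrightarrow> finite (I k)"
  using fold_subset finite_subset by blast

lemma fold_card: "k \<in> {1..K} \<Longrightarrow> card (I k) = n div K"
  using I by (simp add: fold_systems_def)

lemma fold_disjoint: "\<lbrakk>k \<in> {1..K}; l \<in> {1..K}; k \<noteq> l\<rbrakk> \<Longrightarrow> I k \<inter> I l = {}"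
  using I by (simp add: fold_systems_def disjoint_family_on_def)

lemma fold_UN: "(\<Union>k\<in>{1..K}. I k) = {1..n}"
  using I by (simp add: fold_systems_def)

lemma fold_index_eq: "\<lbrakk>k \<in> {1..K}; i \<in> I k\<rbrakk> \<Longrightarrow> fold_index K I i = k"
  unfolding fold_index_def using fold_disjoint by (intro the_equality) blast+

text \<open>Another nonempty fold lies in the complement. Symmetry and measurability of the score
  speak of nonempty datasets only.\<close>

lemma fold_complement_nonempty:
  assumes "K \<ge> 2" "n div K \<ge> 1" "k \<in> {1..K}"
  shows "{1..n} - I k \<noteq> {}"
proof -
  obtain l where l: "l \<in> {1..K}" "l \<noteq> k"
    using assms(1) by (cases "k = 1") (force intro: that[of 2], force intro: that[of 1])
  then have "I l \<noteq> {}" using fold_card[of l] assms(2) by force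
  then show ?thesis using fold_disjoint[OF l(1) assms(3) l(2)] fold_subset[OF l(1)] by blast
qed

text \<open>The leading \<open>1\<close> of the numerator is the test point counting itself. All
  scores of one fold use the same training set, so they are comparable as ranks.\<close>

lemma test_pvalue_eq_rank:
  assumes "k \<in> {1..K}"
  defines "T \<equiv> insert (n + 1) (I k)"
  shows "test_pvalue s n K I z k =
    real (rank_count (score_at s ({1..n} - I k) z) T (n + 1)) / real (card T)"
proof -
  let ?c = "score_at s ({1..n} - I k) z"
  have notin: "n + 1 \<notin> I k" using fold_subset[OF assms(1)] by auto
  have "{i \<in> T. ?c (n + 1) \<le> ?c i} = insert (n + 1) {i \<in> I k. ?c (n + 1) \<le> ?c i}"
    by (auto simp: T_def)
  then have "real (rank_count ?c T (n + 1)) = 1 + real (card {i \<in> I k. ?c (n + 1) \<le> ?c i})"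
    using notin fold_finite[OF assms(1)] by (simp add: rank_count_def)
  also have "\<dots> = 1 + (\<Sum>i\<in>I k. of_bool (?c (n + 1) \<le> ?c i))"
    using fold_finite[OF assms(1)] by (simp add: sum.If_cases of_bool_def Int_def)
  also have "\<dots> = 1 + (\<Sum>i\<in>I k. of_bool (s (z (n + 1)) (subdata z ({1..n} - I k)) \<le> cv_score s n K I z i))"
    using fold_index_eq[OF assms(1)]
    by (intro arg_cong2[where f="(+)"] sum.cong) (auto simp: cv_score_def score_at_def)
  finally show ?thesis
    using notin fold_finite[OF assms(1)] fold_card[OF assms(1)]
    by (simp add: test_pvalue_def cross_pvalue_def T_def)
qed

section \<open>Permutation averages of calibrated p-values for a symmetric score\<close>

context
  fixes N :: "('x \<times> 'y) measure" and s :: "'x \<times> 'y \<Rightarrow> ('x \<times> 'y) list \<Rightarrow> real"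
  assumes sym: "symmetric_score N s" and K: "K \<ge> 2" and m: "n div K \<ge> 1"
begin

lemma rank_count_score_at_permute:
  assumes "k \<in> {1..K}" "\<rho> permutes {1..n+1}" "t \<in> insert (n + 1) (I k)"
    and z: "\<And>i. i \<in> {1..n+1} \<Longrightarrow> z i \<in> space N"
  shows "rank_count (score_at s ({1..n} - I k) (z \<circ> \<rho>)) (insert (n + 1) (I k)) t =
    rank_count (score_at s (\<rho> ` ({1..n} - I k)) z) (\<rho> ` insert (n + 1) (I k)) (\<rho> t)"
proof (rule rank_count_permute)
  show "inj_on \<rho> (insert (n + 1) (I k))"
    using assms(2) by (meson inj_on_subset permutes_inj subset_UNIV)
  fix i assume "i \<in> insert (n + 1) (I k)"
  then have "i \<in> {1..n+1}" using fold_subset[OF assms(1)] by auto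
  then show "score_at s ({1..n} - I k) (z \<circ> \<rho>) i = score_at s (\<rho> ` ({1..n} - I k)) z (\<rho> i)"
    using fold_complement_nonempty[OF K m assms(1)] z
    by (intro score_at_permute[OF sym _ assms(2)]) auto
qed (rule assms(3))

text \<open>Composing with the transposition of \<open>n + 1\<close> and \<open>t\<close> does not
  change the sum over the group. Averaging over all \<open>t\<close> in the fold with the test point
  added reduces the claim, for each permutation, to the rank bound.\<close>

lemma sum_calibrator_test_pvalue_le:
  assumes k: "k \<in> {1..K}" and a: "0 < a"
    and z: "\<And>i. i \<in> {1..n+1} \<Longrightarrow> z i \<in> space N"
  shows "(\<Sum>\<rho> | \<rho> permutes {1..n+1}. calibrator a (test_pvalue s n K I (z \<circ> \<rho>) k))
    \<le> 2 * a * real (card {\<rho>. \<rho> permutes {1..n+1}})"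
proof -
  let ?G = "{\<rho>. \<rho> permutes {1..n+1}}" and ?T = "insert (n + 1) (I k)" and ?J = "{1..n} - I k"
  let ?f = "\<lambda>\<rho>. calibrator a (test_pvalue s n K I (z \<circ> \<rho>) k)"
  let ?r = "\<lambda>\<rho> t. calibrator a (real (rank_count (score_at s ?J (z \<circ> \<rho>)) ?T t) / real (card ?T))"
  have T: "?T \<subseteq> {1..n+1}" "finite ?T" using fold_subset[OF k] fold_finite[OF k] by auto
  \<comment> \<open>The transposition preserves \<open>?T\<close> and fixes the training indices
    \<open>?J\<close>, so only the role of test point moves, from \<open>n + 1\<close> to
    \<open>t\<close>.\<close>
  have swap: "?f (\<rho> \<circ> Transposition.transpose (n + 1) t) = ?r \<rho> t" if \<rho>: "\<rho> \<in> ?G" and t: "t \<in> ?T" for \<rho> t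
  proof -
    let ?\<tau> = "Transposition.transpose (n + 1) t"
    have \<tau>: "?\<tau> permutes {1..n+1}" using t T by (intro permutes_swap_id) auto
    have z\<rho>: "(z \<circ> \<rho>) i \<in> space N" if "i \<in> {1..n+1}" for i
      using that \<rho> z by (metis comp_apply mem_Collect_eq permutes_in_image)
    have "?\<tau> permutes ?T" using t by (intro permutes_swap_id) auto
    then have im: "?\<tau> ` ?T = ?T" by (rule permutes_image)
    have "?\<tau> i = i" if "i \<in> ?J" for i
      using that t by (intro transpose_apply_other) auto
    then have "?\<tau> ` ?J = (\<lambda>i. i) ` ?J" by (intro image_cong refl)
    then have im': "?\<tau> ` ?J = ?J" by simp
    have "rank_count (score_at s ?J (z \<circ> \<rho> \<circ> ?\<tau>)) ?T (n + 1)
        = rank_count (score_at s ?J (z \<circ> \<rho>)) ?T t"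
      using rank_count_score_at_permute[where z="z \<circ> \<rho>" and t="n + 1", OF k \<tau> _ z\<rho>] unfolding im im' by simp
    then show ?thesis by (simp add: test_pvalue_eq_rank[OF k] comp_assoc)
  qed
  have shift: "(\<Sum>\<rho>\<in>?G. ?f (\<rho> \<circ> \<tau>)) = sum ?f ?G" if "\<tau> permutes {1..n+1}" for \<tau>
    using sum_permutations_compose_right[OF that, of ?f] by simp
  have "real (card ?T) * sum ?f ?G = (\<Sum>t\<in>?T. \<Sum>\<rho>\<in>?G. ?f (\<rho> \<circ> Transposition.transpose (n + 1) t))"
    using T by (subst sum.cong[OF refl shift]) (auto intro: permutes_swap_id)
  also have "\<dots> = (\<Sum>\<rho>\<in>?G. \<Sum>t\<in>?T. ?r \<rho> t)"
    by (subst sum.swap) (intro sum.cong refl swap)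
  also have "\<dots> \<le> (\<Sum>\<rho>\<in>?G. 2 * a * real (card ?T))"
    using sum_calibrator_rank_le[OF T(2) a] by (intro sum_mono)
  also have "\<dots> = real (card ?T) * (2 * a * real (card ?G))" by simp
  finally show ?thesis using T(2) by (subst (asm) mult_le_cancel_left) (auto simp: card_gt_0_iff)
qed

text \<open>Equal fold sizes give a bijection from \<open>I 1\<close> to \<open>I j\<close>; it is
  glued with its inverse and the identity into an involution.\<close>

lemma fold_swap_exists:
  assumes "j \<in> {1..K}"
  shows "\<exists>\<rho>. \<rho> permutes {1..n} \<and> (\<forall>k\<in>{1..K}. \<rho> ` I k = I (Transposition.transpose 1 j k))"
proof (cases "j = 1")
  case True
  then show ?thesis by (intro exI[of _ id]) (simp add: permutes_id)
next
  case False
  have one: "1 \<in> {1..K}" using K by simp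
  have disj: "I 1 \<inter> I j = {}" using fold_disjoint[OF one assms] False by simp
  obtain f where f: "bij_betw f (I 1) (I j)"
    using finite_same_card_bij[OF fold_finite[OF one] fold_finite[OF assms]]
      fold_card[OF one] fold_card[OF assms] by auto
  let ?f' = "inv_into (I 1) f"
  have f': "bij_betw ?f' (I j) (I 1)" using f by (rule bij_betw_inv_into)
  define \<rho> where "\<rho> i = (if i \<in> I 1 then f i else if i \<in> I j then ?f' i else i)" for i
  have im1: "\<rho> ` I 1 = I j" using f by (auto simp: \<rho>_def bij_betw_def)
  have "\<rho> ` I j = ?f' ` I j" using disj by (intro image_cong) (auto simp: \<rho>_def)
  then have imj: "\<rho> ` I j = I 1" using f' by (simp add: bij_betw_def)
  have imk: "\<rho> ` A = A" if "A \<inter> I 1 = {}" "A \<inter> I j = {}" for A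
  proof -
    have "\<rho> i = i" if "i \<in> A" for i using that \<open>A \<inter> I 1 = {}\<close> \<open>A \<inter> I j = {}\<close> by (auto simp: \<rho>_def)
    then have "\<rho> ` A = (\<lambda>i. i) ` A" by (intro image_cong refl)
    then show ?thesis by simp
  qed
  have inv: "\<rho> (\<rho> i) = i" for i
  proof -
    have "f i \<in> I j" "?f' (f i) = i" if "i \<in> I 1" for i
      using that f by (auto simp: bij_betw_def)
    moreover have "?f' i \<in> I 1" "f (?f' i) = i" if "i \<in> I j" for i
      using that f f' by (auto simp: bij_betw_def f_inv_into_f)
    ultimately show ?thesis using disj by (auto simp: \<rho>_def)
  qed
  have "\<rho> permutes {1..n}"
    unfolding permutes_def
  proof (intro conjI allI impI)
    fix i assume "i \<notin> {1..n}"
    then show "\<rho> i = i" using fold_subset[OF one] fold_subset[OF assms] by (auto simp: \<rho>_def)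
  next
    fix i show "\<exists>!i'. \<rho> i' = i" using inv by metis
  qed
  moreover have "\<rho> ` I k = I (Transposition.transpose 1 j k)" if k: "k \<in> {1..K}" for k
  proof -
    consider "k = 1" | "k = j" | "k \<noteq> 1" "k \<noteq> j" by blast
    then show ?thesis
    proof cases
      case 3
      then show ?thesis
        using imk[OF fold_disjoint[OF k one] fold_disjoint[OF k assms]]
        by (simp add: transpose_apply_other)
    qed (simp_all only: im1 imj transpose_apply_first transpose_apply_second)
  qed
  ultimately show ?thesis by blast
qed

text \<open>Such a permutation fixes \<open>n + 1\<close> and carries fold \<open>k\<close> and its
  complement to fold \<open>l\<close> and its complement, so ranks are only relabelled.\<close>

lemma test_pvalue_fold_swap:
  assumes "k \<in> {1..K}" "l \<in> {1..K}" "\<rho> permutes {1..n}" "\<rho> ` I k = I l"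
    and z: "\<And>i. i \<in> {1..n+1} \<Longrightarrow> z i \<in> space N"
  shows "test_pvalue s n K I (z \<circ> \<rho>) k = test_pvalue s n K I z l"
proof -
  have \<rho>: "\<rho> permutes {1..n+1}" using assms(3) by (rule permutes_subset) auto
  have top: "\<rho> (n + 1) = n + 1" using assms(3) by (simp add: permutes_def)
  have inj: "inj \<rho>" using assms(3) by (rule permutes_inj)
  have "\<rho> ` ({1..n} - I k) = {1..n} - I l"
    using assms(3,4) inj by (simp add: image_set_diff permutes_image)
  moreover have "\<rho> ` insert (n + 1) (I k) = insert (n + 1) (I l)"
    using top assms(4) by simp
  moreover have "card (insert (n + 1) (I k)) = card (insert (n + 1) (I l))"
    using calculation(2) inj by (metis card_image inj_on_subset subset_UNIV)
  ultimately show ?thesis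
    using rank_count_score_at_permute[OF assms(1) \<rho> _ z, of "n + 1"] top
    by (simp add: test_pvalue_eq_rank[OF assms(1)] test_pvalue_eq_rank[OF assms(2)])
qed

lemma sum_run_avg_test_pvalue_le:
  assumes a: "0 < a" and z: "\<And>i. i \<in> {1..n+1} \<Longrightarrow> z i \<in> space N"
  shows "(\<Sum>\<rho> | \<rho> permutes {1..n+1}. run_avg (\<lambda>k. calibrator a (test_pvalue s n K I (z \<circ> \<rho>) k)) K)
    \<le> 2 * a * real (card {\<rho>. \<rho> permutes {1..n+1}})"
proof -
  let ?G = "{\<rho>. \<rho> permutes {1..n+1}}"
  have "(\<Sum>\<rho>\<in>?G. run_avg (\<lambda>k. calibrator a (test_pvalue s n K I (z \<circ> \<rho>) k)) K)
    = 1 / real K * (\<Sum>k=1..K. \<Sum>\<rho>\<in>?G. calibrator a (test_pvalue s n K I (z \<circ> \<rho>) k))"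
    unfolding run_avg_def sum_distrib_left[symmetric] by (subst sum.swap) simp
  also have "\<dots> \<le> 1 / real K * (\<Sum>k=1..K. 2 * a * real (card ?G))"
    by (intro mult_left_mono sum_mono sum_calibrator_test_pvalue_le[OF _ a z]) auto
  finally show ?thesis using K by simp
qed

text \<open>Right composition with fold swaps permutes the coordinates of the calibrated sequence.
  Optional stopping then replaces the crossing time by time \<open>1\<close>, where validity of a
  single p-value applies.\<close>

lemma sum_run_avg_last_crossing_test_pvalue_le:
  assumes a: "0 < a" and z: "\<And>i. i \<in> {1..n+1} \<Longrightarrow> z i \<in> space N"
  defines "X \<equiv> \<lambda>\<rho> k. calibrator a (test_pvalue s n K I (z \<circ> \<rho>) k)"
  shows "(\<Sum>\<rho> | \<rho> permutes {1..n+1}. run_avg (X \<rho>) (last_crossing K (X \<rho>)))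
    \<le> 2 * a * real (card {\<rho>. \<rho> permutes {1..n+1}})"
proof -
  let ?G = "{\<rho>. \<rho> permutes {1..n+1}}"
  have one: "1 \<in> {1..K}" using K by simp
  have "\<forall>j\<in>{1..K}. \<exists>\<rho>. \<rho> permutes {1..n} \<and> (\<forall>k\<in>{1..K}. \<rho> ` I k = I (Transposition.transpose 1 j k))"
    using fold_swap_exists by blast
  then obtain \<sigma> where \<sigma>: "\<sigma> j permutes {1..n}"
      "k \<in> {1..K} \<Longrightarrow> \<sigma> j ` I k = I (Transposition.transpose 1 j k)"
      if "j \<in> {1..K}" for j k
    by metis
  have \<sigma>': "\<sigma> j permutes {1..n+1}" if "j \<in> {1..K}" for j
    using \<sigma>(1)[OF that] by (rule permutes_subset) auto
  have "(\<Sum>\<rho>\<in>?G. run_avg (X \<rho>) (last_crossing K (X \<rho>))) = (\<Sum>\<rho>\<in>?G. X \<rho> 1)"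
  proof (rule sum_run_avg_last_crossing[where \<Phi>="\<lambda>j \<rho>. \<rho> \<circ> \<sigma> j"])
    show "finite ?G" by (simp add: finite_permutations)
    show "1 \<le> K" using K by simp
    fix j assume j: "j \<in> {1..K}"
    show "(\<lambda>\<rho>. \<rho> \<circ> \<sigma> j) ` ?G \<subseteq> ?G" using permutes_compose[OF \<sigma>'[OF j]] by auto
    \<comment> \<open>Right composition with a surjection can be cancelled.\<close>
    show "inj_on (\<lambda>\<rho>. \<rho> \<circ> \<sigma> j) ?G"
      using permutes_surj[OF \<sigma>'[OF j]] by (auto intro!: inj_onI simp: surj_def fun_eq_iff) metis
    fix \<rho> k assume \<rho>: "\<rho> \<in> ?G" and k: "k \<in> {1..K}"
    have z\<rho>: "(z \<circ> \<rho>) i \<in> space N" if "i \<in> {1..n+1}" for i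
      using that \<rho> z by (metis comp_apply mem_Collect_eq permutes_in_image)
    have "Transposition.transpose 1 j k \<in> {1..K}"
      using j k one by (auto simp: Transposition.transpose_def)
    from test_pvalue_fold_swap[where z="z \<circ> \<rho>", OF k this \<sigma>(1)[OF j] \<sigma>(2)[OF j k] z\<rho>]
    show "X (\<rho> \<circ> \<sigma> j) k = X \<rho> (Transposition.transpose 1 j k)"
      by (simp add: X_def comp_assoc)
  qed
  then show ?thesis using sum_calibrator_test_pvalue_le[OF one a z] by (simp add: X_def)
qed

end

end

subsection \<open>Measurability and symmetrization\<close>

lemma score_at_measurable:
  fixes s :: "'z \<Rightarrow> 'z list \<Rightarrow> real"
  assumes "measurable_score N s" "finite J" "J \<subseteq> A" "J \<noteq> {}" "j \<in> A"
  shows "(\<lambda>z. score_at s J z j) \<in> borel_measurable (\<Pi>\<^sub>M i\<in>A. N)"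
proof -
  define L where "L = sorted_list_of_set J"
  have L: "set L = J" using assms(2) by (simp add: L_def)
  have nth: "L ! i \<in> A" if "i < length L" for i
    using that L assms(3) nth_mem by blast
  have "L \<noteq> []" using L assms(4) by auto
  then have d: "1 \<le> length L" by (simp add: Suc_le_eq)
  \<comment> \<open>The listing \<open>L\<close> of \<open>J\<close> turns the sub-dataset into a
    vector indexed from \<open>0\<close>, the form in which the score is assumed measurable.\<close>
  have "(\<lambda>z. (z j, \<lambda>i\<in>{..<length L}. z (L ! i)))
      \<in> (\<Pi>\<^sub>M i\<in>A. N) \<rightarrow>\<^sub>M N \<Otimes>\<^sub>M (\<Pi>\<^sub>M i\<in>{..<length L}. N)"
    using assms(5) nth
    by (intro measurable_Pair measurable_restrict measurable_component_singleton) auto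
  from measurable_compose[OF this assms(1)[unfolded measurable_score_def, rule_format, OF d]]
  have "(\<lambda>z. s (z j) (map (\<lambda>i\<in>{..<length L}. z (L ! i)) [0..<length L]))
      \<in> borel_measurable (\<Pi>\<^sub>M i\<in>A. N)" by simp
  moreover have "map (\<lambda>i\<in>{..<length L}. z (L ! i)) [0..<length L] = subdata z J" for z :: "nat \<Rightarrow> 'z"
    unfolding subdata_def L_def[symmetric] by (intro nth_equalityI) auto
  ultimately show ?thesis unfolding score_at_def by (simp only:)
qed

lemma test_pvalue_measurable:
  fixes N :: "('x \<times> 'y) measure"
  assumes "I \<in> fold_systems n K" "measurable_score N s" "K \<ge> 2" "n div K \<ge> 1" "k \<in> {1..K}"
  shows "(\<lambda>z. test_pvalue s n K I z k) \<in> borel_measurable (\<Pi>\<^sub>M i\<in>{1..n+1}. N)"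
proof -
  let ?T = "insert (n + 1) (I k)"
  have T: "finite ?T" "?T \<subseteq> {1..n+1}"
    using fold_subset[OF assms(1,5)] fold_finite[OF assms(1,5)] by auto
  have c: "(\<lambda>z. score_at s ({1..n} - I k) z i) \<in> borel_measurable (\<Pi>\<^sub>M i\<in>{1..n+1}. N)"
    if "i \<in> ?T" for i
    using that T fold_complement_nonempty[OF assms(1,3,4,5)]
    by (intro score_at_measurable[OF assms(2)]) auto
  \<comment> \<open>As a finite sum of indicators of score comparisons, the rank is
    measurable.\<close>
  have "real (rank_count c ?T t) = (\<Sum>i\<in>?T. if c t \<le> c i then 1 else 0)" for c :: "nat \<Rightarrow> real" and t
    using T(1) by (subst sum.If_cases) (auto simp: rank_count_def Int_def)
  then have "test_pvalue s n K I z k = (\<Sum>i\<in>?T.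
      if score_at s ({1..n} - I k) z (n + 1) \<le> score_at s ({1..n} - I k) z i then 1 else 0) / real (card ?T)" for z
    by (simp only: test_pvalue_eq_rank[OF assms(1,5)])
  then show ?thesis
    using c by (simp only:) (intro borel_measurable_divide borel_measurable_sum measurable_If
      borel_measurable_const borel_measurable_le, auto)
qed

lemma run_avg_measurable:
  assumes "\<And>k. k \<in> {1..l} \<Longrightarrow> (\<lambda>x. f x k) \<in> borel_measurable M"
  shows "(\<lambda>x. run_avg (f x) l) \<in> borel_measurable M"
  unfolding run_avg_def using assms
  by (intro borel_measurable_times borel_measurable_const borel_measurable_sum)

text \<open>This permits replacing the raw data by \<open>data_vector\<close>, which is
  \<open>undefined\<close> outside its index set.\<close>

lemma test_pvalue_cong:
  assumes "I \<in> fold_systems n K" "k \<in> {1..K}" "\<And>i. i \<in> {1..n+1} \<Longrightarrow> z i = z' i"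
  shows "test_pvalue s n K I z k = test_pvalue s n K I z' k"
proof -
  have sub: "subdata z ({1..n} - I k) = subdata z' ({1..n} - I k)"
    using assms(3) by (simp add: subdata_def)
  have "rank_count (score_at s ({1..n} - I k) z) (insert (n + 1) (I k)) (n + 1)
      = rank_count (score_at s ({1..n} - I k) z') ((\<lambda>i. i) ` insert (n + 1) (I k)) (n + 1)"
  proof (rule rank_count_permute)
    fix i assume "i \<in> insert (n + 1) (I k)"
    then have "i \<in> {1..n+1}" using fold_subset[OF assms(1,2)] by auto
    then show "score_at s ({1..n} - I k) z i = score_at s ({1..n} - I k) z' i"
      using assms(3) sub by (simp add: score_at_def)
  qed auto
  then show ?thesis by (simp add: test_pvalue_eq_rank[OF assms(1,2)])
qed

text \<open>By independence both measures agree on rectangles, which determines a product of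
  sigma-finite measures.\<close>

lemma distr_Pair_eq_pair_measure:
  assumes "prob_space M" "A \<in> M \<rightarrow>\<^sub>M S" "B \<in> M \<rightarrow>\<^sub>M T" "indep_rv M S A T B"
  shows "distr M (S \<Otimes>\<^sub>M T) (\<lambda>\<omega>. (A \<omega>, B \<omega>)) = distr M S A \<Otimes>\<^sub>M distr M T B"
proof -
  interpret prob_space M by fact
  interpret A: prob_space "distr M S A" using assms(2) by (rule prob_space_distr)
  interpret B: prob_space "distr M T B" using assms(3) by (rule prob_space_distr)
  show ?thesis
  proof (rule pair_measure_eqI[symmetric])
    show "sets (distr M S A \<Otimes>\<^sub>M distr M T B) = sets (distr M (S \<Otimes>\<^sub>M T) (\<lambda>\<omega>. (A \<omega>, B \<omega>)))"
      by (simp cong: sets_pair_measure_cong)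
    fix C D assume "C \<in> sets (distr M S A)" "D \<in> sets (distr M T B)"
    then have C: "C \<in> sets S" and D: "D \<in> sets T" by simp_all
    have "prob ((A -` C \<inter> space M) \<inter> (B -` D \<inter> space M)) = prob (A -` C \<inter> space M) * prob (B -` D \<inter> space M)"
      using assms(4) C D unfolding indep_rv_def by (intro indep_setD) auto
    moreover have "(\<lambda>\<omega>. (A \<omega>, B \<omega>)) -` (C \<times> D) \<inter> space M = (A -` C \<inter> space M) \<inter> (B -` D \<inter> space M)"
      by auto
    ultimately show "emeasure (distr M S A) C * emeasure (distr M T B) D
        = emeasure (distr M (S \<Otimes>\<^sub>M T) (\<lambda>\<omega>. (A \<omega>, B \<omega>))) (C \<times> D)"
      using C D assms(2,3)
      by (simp add: emeasure_distr measurable_Pair emeasure_eq_measure ennreal_mult)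
  qed (rule A.sigma_finite_measure_axioms B.sigma_finite_measure_axioms)+
qed

lemma indep_rv_sym:
  assumes "prob_space M" "indep_rv M S A T B"
  shows "indep_rv M T B S A"
proof -
  interpret prob_space M by fact
  show ?thesis
    using assms(2) unfolding indep_rv_def indep_sets2_eq
    by (metis (no_types, lifting) Int_commute mult.commute)
qed

section \<open>Permutation invariance of laws and randomized events\<close>

lemma data_vector_permute:
  "\<rho> permutes A \<Longrightarrow> data_vector A (\<lambda>j. Z (\<rho> j)) \<omega> = data_vector A Z \<omega> \<circ> \<rho>"
  \<comment> \<open>Off \<open>A\<close> both sides are \<open>undefined\<close>, since
    \<open>\<rho>\<close> fixes these indices.\<close>
  by (auto simp: data_vector_def fun_eq_iff permutes_in_image restrict_def)

lemma measurable_comp_permutes: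
  assumes "\<rho> permutes A"
  shows "(\<lambda>z. z \<circ> \<rho>) \<in> (\<Pi>\<^sub>M j\<in>A. N) \<rightarrow>\<^sub>M (\<Pi>\<^sub>M j\<in>A. N)"
proof -
  have "(\<lambda>z. \<lambda>j\<in>A. z (\<rho> j)) \<in> (\<Pi>\<^sub>M j\<in>A. N) \<rightarrow>\<^sub>M (\<Pi>\<^sub>M j\<in>A. N)"
    using permutes_in_image[OF assms]
    by (intro measurable_restrict measurable_component_singleton) simp
  moreover have "z \<circ> \<rho> = (\<lambda>j\<in>A. z (\<rho> j))" if "z \<in> space (\<Pi>\<^sub>M j\<in>A. N)" for z
    using that assms
    by (auto simp: fun_eq_iff space_PiM PiE_iff extensional_def permutes_def)
  ultimately show ?thesis by (subst measurable_cong) auto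
qed

lemma exchangeable_distr_comp:
  assumes "exchangeable M N A Z" "\<rho> permutes A" "data_vector A Z \<in> M \<rightarrow>\<^sub>M (\<Pi>\<^sub>M j\<in>A. N)"
  defines "D \<equiv> distr M (\<Pi>\<^sub>M j\<in>A. N) (data_vector A Z)"
  shows "distr D (\<Pi>\<^sub>M j\<in>A. N) (\<lambda>z. z \<circ> \<rho>) = D"
proof -
  have "distr D (\<Pi>\<^sub>M j\<in>A. N) (\<lambda>z. z \<circ> \<rho>) = distr M (\<Pi>\<^sub>M j\<in>A. N) (data_vector A (\<lambda>j. Z (\<rho> j)))"
    unfolding D_def using measurable_comp_permutes[OF assms(2)] assms(3)
    by (subst distr_distr) (auto simp: data_vector_permute[OF assms(2)] comp_def intro!: distr_cong)
  then show ?thesis using assms(1,2) by (simp add: exchangeable_def D_def)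
qed

text \<open>All \<open>f (z \<circ> \<rho>)\<close> have the same integral, so the integral of
  \<open>f\<close> is that of the mean over permutations, which is at most \<open>c\<close>
  pointwise.\<close>

lemma nn_integral_exchangeable_le:
  assumes "prob_space M" "exchangeable M N A Z" "finite A"
    and meas: "data_vector A Z \<in> M \<rightarrow>\<^sub>M (\<Pi>\<^sub>M j\<in>A. N)" "f \<in> borel_measurable (\<Pi>\<^sub>M j\<in>A. N)"
    and le: "\<And>z. z \<in> space (\<Pi>\<^sub>M j\<in>A. N) \<Longrightarrow>
               (\<Sum>\<rho> | \<rho> permutes A. f (z \<circ> \<rho>)) \<le> ennreal (c * real (card {\<rho>. \<rho> permutes A}))"
    and c: "0 \<le> c"
  shows "(\<integral>\<^sup>+z. f z \<partial>distr M (\<Pi>\<^sub>M j\<in>A. N) (data_vector A Z)) \<le> ennreal c"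
proof -
  let ?D = "distr M (\<Pi>\<^sub>M j\<in>A. N) (data_vector A Z)" and ?G = "{\<rho>. \<rho> permutes A}"
  interpret D: prob_space ?D using assms(1) meas(1) by (rule prob_space.prob_space_distr)
  have G: "finite ?G" "0 < card ?G"
    using assms(3) finite_permutations[of A] permutes_id[of A] by (auto simp: card_gt_0_iff simp del: permutes_id)
  have shift: "(\<integral>\<^sup>+z. f (z \<circ> \<rho>) \<partial>?D) = (\<integral>\<^sup>+z. f z \<partial>?D)" if "\<rho> \<in> ?G" for \<rho>
  proof -
    have "(\<integral>\<^sup>+z. f z \<partial>?D) = (\<integral>\<^sup>+z. f z \<partial>distr ?D (\<Pi>\<^sub>M j\<in>A. N) (\<lambda>z. z \<circ> \<rho>))"
      using exchangeable_distr_comp[OF assms(2) _ meas(1)] that by simp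
    also have "\<dots> = (\<integral>\<^sup>+z. f (z \<circ> \<rho>) \<partial>?D)"
      using measurable_comp_permutes[of \<rho> A N] that meas(2) by (intro nn_integral_distr) auto
    finally show ?thesis ..
  qed
  have "of_nat (card ?G) * (\<integral>\<^sup>+z. f z \<partial>?D) = (\<Sum>\<rho>\<in>?G. \<integral>\<^sup>+z. f (z \<circ> \<rho>) \<partial>?D)"
    using shift by simp
  also have "\<dots> = (\<integral>\<^sup>+z. (\<Sum>\<rho>\<in>?G. f (z \<circ> \<rho>)) \<partial>?D)"
    using measurable_compose[OF measurable_comp_permutes meas(2)]
    by (intro nn_integral_sum[symmetric]) auto
  also have "\<dots> \<le> (\<integral>\<^sup>+z. ennreal (c * real (card ?G)) \<partial>?D)"
    using le by (intro nn_integral_mono) simp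
  also have "\<dots> = of_nat (card ?G) * ennreal c"
    using c D.emeasure_space_1
    by (simp add: ennreal_mult'' mult.commute ennreal_of_nat_eq_real_of_nat)
  finally show ?thesis
    using G(2) by (subst (asm) ennreal_mult_le_mult_iff) auto
qed

text \<open>Within the unit interval the event lies in \<open>{0..h}\<close>, whose length is
  \<open>h\<close>.\<close>

lemma emeasure_uniform_le:
  assumes "{u. P u} \<in> sets borel" "\<And>u. \<lbrakk>0 < u; u < 1; P u\<rbrakk> \<Longrightarrow> u \<le> h" "0 \<le> h"
  shows "emeasure (uniform_measure lborel {0<..<1::real}) {u. P u} \<le> ennreal h"
proof -
  have "emeasure (uniform_measure lborel {0<..<1}) {u. P u} = emeasure lborel ({0<..<1} \<inter> {u. P u})"
    using assms(1) by (subst emeasure_uniform_measure) (auto simp: divide_ennreal_def)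
  also have "\<dots> \<le> emeasure lborel {0..h}"
    using assms(2) by (intro emeasure_mono) auto
  finally show ?thesis using assms(3) by simp
qed

text \<open>Three integrations of a product law: over \<open>U\<close> at fixed data and folds,
  giving at most \<open>h\<close>; over the data at fixed folds, where exchangeability reduces
  \<open>h\<close> to its permutation mean; and over the folds, a bound by a constant.\<close>

lemma randomized_exchangeable_prob_le:
  fixes M :: "'w measure" and N :: "'z measure" and U :: "'w \<Rightarrow> real" and I :: "'w \<Rightarrow> 'i"
  assumes M: "prob_space M" and fin: "finite A" "countable F"
    and exch: "exchangeable M N A Z"
    and Z: "data_vector A Z \<in> M \<rightarrow>\<^sub>M (\<Pi>\<^sub>M j\<in>A. N)"
    and I: "I \<in> M \<rightarrow>\<^sub>M count_space F"
    and I_indep: "indep_rv M (count_space F) I (\<Pi>\<^sub>M j\<in>A. N) (data_vector A Z)"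
    and U: "U \<in> borel_measurable M" and U_unif: "distr M borel U = uniform_measure lborel {0<..<1}"
    and U_indep: "indep_rv M borel U ((\<Pi>\<^sub>M j\<in>A. N) \<Otimes>\<^sub>M count_space F)
           (\<lambda>\<omega>. (data_vector A Z \<omega>, I \<omega>))"
    and bad: "\<And>J. J \<in> F \<Longrightarrow> Measurable.pred (borel \<Otimes>\<^sub>M (\<Pi>\<^sub>M j\<in>A. N)) (\<lambda>x. bad J (fst x) (snd x))"
    and dom: "\<And>J u z. \<lbrakk>J \<in> F; 0 < u; u < 1; bad J u z\<rbrakk> \<Longrightarrow> u \<le> h J z"
    and h: "\<And>J z. 0 \<le> h J z" and c: "0 \<le> c"
    and sum_le: "\<And>J z. \<lbrakk>J \<in> F; z \<in> space (\<Pi>\<^sub>M j\<in>A. N)\<rbrakk> \<Longrightarrow>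
               (\<Sum>\<rho> | \<rho> permutes A. h J (z \<circ> \<rho>)) \<le> c * real (card {\<rho>. \<rho> permutes A})"
  shows "{\<omega> \<in> space M. bad (I \<omega>) (U \<omega>) (data_vector A Z \<omega>)} \<in> sets M" (is "?E \<in> _")
    and "measure M {\<omega> \<in> space M. bad (I \<omega>) (U \<omega>) (data_vector A Z \<omega>)} \<le> c"
proof -
  let ?P = "\<Pi>\<^sub>M j\<in>A. N" and ?W = "uniform_measure lborel {0<..<1::real}"
  let ?D = "distr M ?P (data_vector A Z)" and ?J = "distr M (count_space F) I"
  let ?PF = "?P \<Otimes>\<^sub>M count_space F"
  let ?B = "{x \<in> space (borel \<Otimes>\<^sub>M ?PF). bad (snd (snd x)) (fst x) (fst (snd x))}"
  interpret prob_space M by (rule M)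
  interpret D: prob_space ?D using Z by (rule prob_space_distr)
  interpret J: prob_space ?J using I by (rule prob_space_distr)
  interpret W: prob_space ?W unfolding U_unif[symmetric] using U by (rule prob_space_distr)
  interpret DJ: pair_prob_space ?D ?J ..
  interpret WDJ: pair_prob_space ?W "?D \<Otimes>\<^sub>M ?J" ..
  have setsDJ: "sets (?D \<Otimes>\<^sub>M ?J) = sets ?PF" by (intro sets_pair_measure_cong) simp_all
  have setsW: "sets (?W \<Otimes>\<^sub>M (?D \<Otimes>\<^sub>M ?J)) = sets (borel \<Otimes>\<^sub>M ?PF)"
    using setsDJ by (intro sets_pair_measure_cong) simp_all
  \<comment> \<open>Countability of \<open>F\<close> reduces joint measurability to a fixed fold
    system.\<close>
  have "Measurable.pred (borel \<Otimes>\<^sub>M ?PF) (\<lambda>x. bad (snd (snd x)) (fst x) (fst (snd x)))"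
  proof (rule measurable_compose_countable'[where g="\<lambda>x. snd (snd x)", OF _ _ fin(2)])
    fix J assume "J \<in> F"
    have "(\<lambda>x. (fst x, fst (snd x))) \<in> borel \<Otimes>\<^sub>M ?PF \<rightarrow>\<^sub>M borel \<Otimes>\<^sub>M ?P" by measurable
    from measurable_compose[OF this bad[OF \<open>J \<in> F\<close>]]
    show "Measurable.pred (borel \<Otimes>\<^sub>M ?PF) (\<lambda>x. bad J (fst x) (fst (snd x)))" by simp
  qed measurable
  then have B: "?B \<in> sets (borel \<Otimes>\<^sub>M ?PF)" by measurable
  have DI: "(\<lambda>\<omega>. (data_vector A Z \<omega>, I \<omega>)) \<in> M \<rightarrow>\<^sub>M ?PF" using Z I by measurable
  have UDI: "(\<lambda>\<omega>. (U \<omega>, data_vector A Z \<omega>, I \<omega>)) \<in> M \<rightarrow>\<^sub>M borel \<Otimes>\<^sub>M ?PF"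
    using U DI by measurable
  have E: "?E = (\<lambda>\<omega>. (U \<omega>, data_vector A Z \<omega>, I \<omega>)) -` ?B \<inter> space M"
    using measurable_space[OF UDI] by auto
  show "?E \<in> sets M" unfolding E using UDI B by (rule measurable_sets)
  have joint: "distr M (borel \<Otimes>\<^sub>M ?PF) (\<lambda>\<omega>. (U \<omega>, data_vector A Z \<omega>, I \<omega>)) = ?W \<Otimes>\<^sub>M (?D \<Otimes>\<^sub>M ?J)"
    using distr_Pair_eq_pair_measure[OF M U DI U_indep] U_unif
      distr_Pair_eq_pair_measure[OF M Z I indep_rv_sym[OF M I_indep]] by simp
  \<comment> \<open>The conditional probability of the bad event given data and folds.\<close>
  define \<phi> where "\<phi> x = emeasure ?W ((\<lambda>u. (u, x)) -` ?B)" for x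
  have \<phi>: "\<phi> \<in> borel_measurable (?D \<Otimes>\<^sub>M ?J)"
    unfolding \<phi>_def using B setsW by (intro WDJ.measurable_emeasure_Pair2) simp
  have \<phi>_le: "\<phi> (z, J) \<le> ennreal (h J z)" if "z \<in> space ?P" "J \<in> F" for z J
  proof -
    have "(\<lambda>u. (u, z, J)) -` ?B = {u. bad J u z}"
      using that by (auto simp: space_pair_measure)
    moreover have "{u. bad J u z} \<in> sets borel"
      using measurable_compose[OF measurable_Pair2'[OF that(1)] bad[OF that(2)]]
      by (simp add: pred_def)
    ultimately show ?thesis
      unfolding \<phi>_def using emeasure_uniform_le[OF _ dom[OF that(2)] h, of "\<lambda>u. bad J u z" z] by simp
  qed
  have inner: "(\<integral>\<^sup>+z. \<phi> (z, J) \<partial>?D) \<le> ennreal c" if J: "J \<in> F" for J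
  proof (rule nn_integral_exchangeable_le[OF M exch fin(1) Z _ _ c])
    show "(\<lambda>z. \<phi> (z, J)) \<in> borel_measurable ?P"
      using measurable_compose[OF measurable_Pair2' \<phi>] J by simp
    fix z assume z: "z \<in> space ?P"
    have "z \<circ> \<rho> \<in> space ?P" if "\<rho> permutes A" for \<rho>
      using measurable_space[OF measurable_comp_permutes[OF that] z] .
    then have "(\<Sum>\<rho> | \<rho> permutes A. \<phi> (z \<circ> \<rho>, J)) \<le> (\<Sum>\<rho> | \<rho> permutes A. ennreal (h J (z \<circ> \<rho>)))"
      using \<phi>_le J by (intro sum_mono) auto
    also have "\<dots> = ennreal (\<Sum>\<rho> | \<rho> permutes A. h J (z \<circ> \<rho>))"
      using h by (intro sum_ennreal) auto
    also have "\<dots> \<le> ennreal (c * real (card {\<rho>. \<rho> permutes A}))"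
      using sum_le[OF J z] by (rule ennreal_leI)
    finally show "(\<Sum>\<rho> | \<rho> permutes A. \<phi> (z \<circ> \<rho>, J)) \<le> \<dots>" .
  qed
  have "emeasure M ?E = emeasure (?W \<Otimes>\<^sub>M (?D \<Otimes>\<^sub>M ?J)) ?B"
    unfolding joint[symmetric] E using UDI B by (rule emeasure_distr[symmetric])
  also have "\<dots> = (\<integral>\<^sup>+x. \<phi> x \<partial>(?D \<Otimes>\<^sub>M ?J))"
    unfolding \<phi>_def using B setsW by (intro WDJ.emeasure_pair_measure_alt2) simp
  \<comment> \<open>The folds are integrated last because the bound on the data integral holds for
    each fixed \<open>J\<close>.\<close>
  also have "\<dots> = (\<integral>\<^sup>+J. (\<integral>\<^sup>+z. \<phi> (z, J) \<partial>?D) \<partial>?J)"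
    by (rule DJ.nn_integral_snd[OF \<phi>, symmetric])
  also have "\<dots> \<le> (\<integral>\<^sup>+J. ennreal c \<partial>?J)"
    using inner by (intro nn_integral_mono) simp
  also have "\<dots> = ennreal c" using J.emeasure_space_1 by simp
  finally show "measure M ?E \<le> c"
    using c by (simp add: emeasure_eq_measure)
qed

subsection \<open>Prediction sets\<close>

text \<open>The folds partition \<open>{1..n}\<close>, each contributes one leading
  \<open>1\<close>, and \<open>K\<close> times the common denominator is
  \<open>K + n\<close>.\<close>

lemma run_avg_cross_pvalue:
  assumes I: "I \<in> fold_systems n K" and "K \<ge> 1" "K dvd n"
  shows "run_avg (\<lambda>k. cross_pvalue s n K I z x k y) K =
    (real K + (\<Sum>i=1..n. of_bool (s (x, y) (subdata z ({1..n} - I (fold_index K I i))) \<le> cv_score s n K I z i)))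
      / (real K + real n)"
proof -
  define m where "m = n div K"
  have n: "real n = real K * real m"
    using assms(3) unfolding m_def by (metis dvd_mult_div_cancel of_nat_mult)
  define f where "f i = (of_bool (s (x, y) (subdata z ({1..n} - I (fold_index K I i))) \<le> cv_score s n K I z i) :: real)" for i
  have fold: "cross_pvalue s n K I z x k y = (1 + (\<Sum>i\<in>I k. f i)) / (real m + 1)" if "k \<in> {1..K}" for k
    using fold_index_eq[OF I that] by (simp add: cross_pvalue_def f_def m_def)
  have "(\<Sum>i=1..n. f i) = (\<Sum>k=1..K. \<Sum>i\<in>I k. f i)"
    unfolding fold_UN[OF I, symmetric]
    by (rule sum.UNION_disjoint) (use fold_finite[OF I] fold_disjoint[OF I] in auto)
  moreover have "(\<Sum>k=1..K. cross_pvalue s n K I z x k y) = (\<Sum>k=1..K. (1 + (\<Sum>i\<in>I k. f i)) / (real m + 1))"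
    by (intro sum.cong refl fold)
  ultimately have "(\<Sum>k=1..K. cross_pvalue s n K I z x k y) = (real K + (\<Sum>i=1..n. f i)) / (real m + 1)"
    by (simp add: sum.distrib flip: sum_divide_distrib)
  moreover have "real K * (real m + 1) = real K + real n" by (simp add: n algebra_simps)
  ultimately show ?thesis
    unfolding run_avg_def f_def[symmetric] by (simp add: divide_divide_eq_left mult.commute)
qed

lemma run_avg_cross_pvalue_imp_cross:
  assumes I: "I \<in> fold_systems n K" and K: "K \<ge> 1" "K dvd n"
    and \<alpha>': "\<alpha>' = \<alpha> + (1 - \<alpha>) * ((real K - 1) / (real K + real n))"
    and gt: "run_avg (\<lambda>k. cross_pvalue s n K I z x k y) K > \<alpha>'"
  shows "(1 + (\<Sum>i=1..n. of_bool (s (x, y) (subdata z ({1..n} - I (fold_index K I i))) \<le> cv_score s n K I z i)))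
      / (real n + 1) > \<alpha>"
proof -
  let ?S = "\<Sum>i=1..n. of_bool (s (x, y) (subdata z ({1..n} - I (fold_index K I i))) \<le> cv_score s n K I z i) :: real"
  have pos: "0 < real K + real n" using K by simp
  have "\<alpha>' * (real K + real n) < real K + ?S"
    using gt pos unfolding run_avg_cross_pvalue[OF I K] by (simp add: pos_less_divide_eq)
  \<comment> \<open>The level \<open>\<alpha>'\<close> is chosen for this identity: the
    \<open>K - 1\<close> surplus ones of the averaged p-values cancel exactly.\<close>
  moreover have "\<alpha>' * (real K + real n) = \<alpha> * (real n + 1) + (real K - 1)"
    using pos unfolding \<alpha>' by (simp add: field_simps)
  ultimately show ?thesis by (simp add: pos_less_divide_eq)
qed

lemma cross_pvalue_nonneg: "0 \<le> cross_pvalue s n K I z x k y"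
  by (simp add: cross_pvalue_def sum_nonneg)

lemma e_mod_cross_set_subset:
  assumes I: "I \<in> fold_systems n K" and K: "K \<ge> 1" "K dvd n"
    and \<alpha>': "\<alpha>' = \<alpha> + (1 - \<alpha>) * ((real K - 1) / (real K + real n))"
  shows "e_mod_cross_set V s n K I \<alpha>' z x \<subseteq> cross_set V s n K I \<alpha> z x"
proof
  fix y assume y: "y \<in> e_mod_cross_set V s n K I \<alpha>' z x"
  have "(MIN l\<in>{1..K}. run_avg (\<lambda>k. cross_pvalue s n K I z x k y) l)
      \<le> run_avg (\<lambda>k. cross_pvalue s n K I z x k y) K"
    using K by (intro Min_le) auto
  with y have "\<alpha>' < run_avg (\<lambda>k. cross_pvalue s n K I z x k y) K"
    by (simp add: e_mod_cross_set_def run_avg_def)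
  from run_avg_cross_pvalue_imp_cross[OF I K \<alpha>' this] y
  show "y \<in> cross_set V s n K I \<alpha> z x"
    by (simp add: e_mod_cross_set_def cross_set_def)
qed

lemma u_mod_cross_set_subset:
  assumes I: "I \<in> fold_systems n K" and K: "K \<ge> 1" "K dvd n"
    and \<alpha>': "\<alpha>' = \<alpha> + (1 - \<alpha>) * ((real K - 1) / (real K + real n))"
    and u: "0 < u" "u < 1"
  shows "u_mod_cross_set V s n K I \<alpha>' u z x \<subseteq> cross_set V s n K I \<alpha> z x"
proof
  fix y assume y: "y \<in> u_mod_cross_set V s n K I \<alpha>' u z x"
  let ?A = "run_avg (\<lambda>k. cross_pvalue s n K I z x k y) K"
  have "\<alpha>' < 1 / (2 - u) * ?A" using y by (simp add: u_mod_cross_set_def run_avg_def)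
  also have "\<dots> \<le> 1 * ?A"
    \<comment> \<open>Here \<open>2 - u > 1\<close>, so the random factor only shrinks a nonnegative
      average.\<close>
    using u run_avg_nonneg[OF cross_pvalue_nonneg] by (intro mult_right_mono) auto
  finally have "\<alpha>' < ?A" by simp
  from run_avg_cross_pvalue_imp_cross[OF I K \<alpha>' this] y
  show "y \<in> cross_set V s n K I \<alpha> z x"
    by (simp add: u_mod_cross_set_def cross_set_def)
qed

lemma eu_mod_cross_set_subset:
  "eu_mod_cross_set V s n K I a u z x \<subseteq> e_mod_cross_set V s n K I a z x"
  by (auto simp: eu_mod_cross_set_def e_mod_cross_set_def)

section \<open>Inclusions and coverage for random data, folds and randomization\<close>

theorem theorem4p9:
  fixes M :: "'w measure" and MX :: "'x measure" and MY :: "'y measure"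
    and Z :: "nat \<Rightarrow> 'w \<Rightarrow> 'x \<times> 'y" and s :: "'x \<times> 'y \<Rightarrow> ('x \<times> 'y) list \<Rightarrow> real"
    and I :: "'w \<Rightarrow> nat \<Rightarrow> nat set" and U :: "'w \<Rightarrow> real"
    and n K :: nat and \<alpha> \<alpha>' :: real
  assumes "prob_space M"
    and "0 < \<alpha>" and "\<alpha> < 1"
    and "\<alpha>' = \<alpha> + (1 - \<alpha>) * ((real K - 1) / (real K + real n))"
    and "n \<ge> 1" and "K \<ge> 2" and "K dvd n"
    and "measurable_score (MX \<Otimes>\<^sub>M MY) s" and "symmetric_score (MX \<Otimes>\<^sub>M MY) s"
    and Z_rv: "\<And>i. i \<in> {1..n+1} \<Longrightarrow> Z i \<in> M \<rightarrow>\<^sub>M (MX \<Otimes>\<^sub>M MY)"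
    and I_rv: "I \<in> M \<rightarrow>\<^sub>M count_space (fold_systems n K)"
    and I_indep: "indep_rv M (count_space (fold_systems n K)) I
           (\<Pi>\<^sub>M j\<in>{1..n+1}. MX \<Otimes>\<^sub>M MY) (data_vector {1..n+1} Z)"
    and U_rv: "U \<in> borel_measurable M" and U_range: "\<And>\<omega>. \<omega> \<in> space M \<Longrightarrow> U \<omega> \<in> {0<..<1}"
    and U_unif: "distr M borel U = uniform_measure lborel {0<..<1}"
    and U_indep: "indep_rv M borel U
           ((\<Pi>\<^sub>M j\<in>{1..n+1}. MX \<Otimes>\<^sub>M MY) \<Otimes>\<^sub>M count_space (fold_systems n K))
           (\<lambda>\<omega>. (data_vector {1..n+1} Z \<omega>, I \<omega>))"
  shows "let z = (\<lambda>\<omega> i. Z i \<omega>);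
             X = (\<lambda>i \<omega>. fst (Z i \<omega>));
             Y = (\<lambda>i \<omega>. snd (Z i \<omega>));
             C_cross = (\<lambda>\<omega>. cross_set (space MY) s n K (I \<omega>) \<alpha> (z \<omega>) (X (n+1) \<omega>));
             C_e = (\<lambda>\<omega>. e_mod_cross_set (space MY) s n K (I \<omega>) \<alpha>' (z \<omega>) (X (n+1) \<omega>));
             C_u = (\<lambda>\<omega>. u_mod_cross_set (space MY) s n K (I \<omega>) \<alpha>' (U \<omega>) (z \<omega>) (X (n+1) \<omega>));
             C_eu = (\<lambda>\<omega>. eu_mod_cross_set (space MY) s n K (I \<omega>) \<alpha>' (U \<omega>) (z \<omega>) (X (n+1) \<omega>))
         in (\<forall>\<omega>\<in>space M. C_e \<omega> \<subseteq> C_cross \<omega> \<and> C_u \<omega> \<subseteq> C_cross \<omega> \<and>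
                         C_eu \<omega> \<subseteq> C_e \<omega> \<and> C_e \<omega> \<subseteq> C_cross \<omega>) \<and>
            (exchangeable M (MX \<Otimes>\<^sub>M MY) {1..n+1} Z \<longrightarrow>
               (\<forall>C\<in>{C_e, C_u, C_eu}.
                  measure M {\<omega> \<in> space M. Y (n+1) \<omega> \<in> C \<omega>} \<ge> 1 - 2 * \<alpha>'))"
proof -
  interpret prob_space M by fact
  let ?N = "MX \<Otimes>\<^sub>M MY" and ?A = "{1..n+1}" and ?F = "fold_systems n K"
  let ?P = "\<Pi>\<^sub>M j\<in>?A. ?N" and ?D = "data_vector {1..n+1} Z"
  let ?p = "\<lambda>J z. test_pvalue s n K J z"
  have a: "0 < \<alpha>'" using assms(2-6) by (simp add: add_pos_nonneg)
  have K: "1 \<le> K" "K \<ge> 2" using assms(6) by auto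
  have m: "n div K \<ge> 1" using assms(5-7) by (auto elim!: dvdE simp: Suc_le_eq)
  have I_in: "I \<omega> \<in> ?F" if "\<omega> \<in> space M" for \<omega>
    using measurable_space[OF I_rv that] by simp
  have F: "countable ?F"
  proof -
    have "finite ({1..K} \<rightarrow>\<^sub>E Pow {1..n})" by (intro finite_PiE) auto
    then show ?thesis by (intro countable_finite) (auto simp: fold_systems_def intro: finite_subset[rotated])
  qed
  have D: "?D \<in> M \<rightarrow>\<^sub>M ?P"
    unfolding data_vector_def using Z_rv by (intro measurable_restrict) auto
  have pD: "?p (I \<omega>) (?D \<omega>) k = cross_pvalue s n K (I \<omega>) (\<lambda>i. Z i \<omega>) (fst (Z (n+1) \<omega>)) k (snd (Z (n+1) \<omega>))"
    if "\<omega> \<in> space M" "k \<in> {1..K}" for \<omega> k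
  proof -
    have "?p (I \<omega>) (?D \<omega>) k = ?p (I \<omega>) (\<lambda>i. Z i \<omega>) k"
      by (rule test_pvalue_cong[OF I_in[OF that(1)] that(2)]) (simp add: data_vector_def)
    then show ?thesis by (simp add: test_pvalue_def)
  qed
  have avgD: "run_avg (?p (I \<omega>) (?D \<omega>)) l = 1 / real l * (\<Sum>k=1..l.
      cross_pvalue s n K (I \<omega>) (\<lambda>i. Z i \<omega>) (fst (Z (n+1) \<omega>)) k (snd (Z (n+1) \<omega>)))"
    if "\<omega> \<in> space M" "l \<in> {1..K}" for \<omega> l
    unfolding run_avg_def using that by (intro arg_cong2[where f="(*)"] sum.cong refl pD) auto
  have Y: "snd (Z (n+1) \<omega>) \<in> space MY" if "\<omega> \<in> space M" for \<omega>
    using measurable_space[OF Z_rv[of "n+1"] that] by (auto simp: space_pair_measure)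
  have spaceN: "z i \<in> space ?N" if "z \<in> space ?P" "i \<in> ?A" for z i
    using that by (auto simp: space_PiM)
  have p_meas: "(\<lambda>x. ?p J (snd x) k) \<in> borel_measurable (borel \<Otimes>\<^sub>M ?P)" if "J \<in> ?F" "k \<in> {1..K}" for J k
    using measurable_compose[OF measurable_snd test_pvalue_measurable[OF that(1) assms(8) K(2) m that(2)]] .
  have avg_meas: "(\<lambda>x. run_avg (?p J (snd x)) l) \<in> borel_measurable (borel \<Otimes>\<^sub>M ?P)" if "J \<in> ?F" "l \<in> {1..K}" for J l
    using that by (intro run_avg_measurable p_meas) auto
  have fst_meas: "fst \<in> borel_measurable ((borel :: real measure) \<Otimes>\<^sub>M ?P)" by measurable
  \<comment> \<open>Common scheme: a set is given by a threshold \<open>\<alpha>' < f\<close>, and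
    \<open>h\<close> dominates every \<open>u\<close> at which \<open>f\<close> fails it.\<close>
  have coverage: "1 - 2 * \<alpha>' \<le> prob {\<omega> \<in> space M. snd (Z (n+1) \<omega>) \<in> C \<omega>}"
    if exch: "exchangeable M ?N ?A Z"
      and C: "\<And>\<omega>. \<omega> \<in> space M \<Longrightarrow> snd (Z (n+1) \<omega>) \<in> C \<omega> \<longleftrightarrow> \<alpha>' < f (I \<omega>) (U \<omega>) (?D \<omega>)"
      and f: "\<And>J. J \<in> ?F \<Longrightarrow> (\<lambda>x. f J (fst x) (snd x)) \<in> borel_measurable (borel \<Otimes>\<^sub>M ?P)"
      and dom: "\<And>J u z. \<lbrakk>J \<in> ?F; 0 < u; u < 1; f J u z \<le> \<alpha>'\<rbrakk> \<Longrightarrow> u \<le> h J z"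
      and h: "\<And>J z. 0 \<le> h J z"
      and sum: "\<And>J z. \<lbrakk>J \<in> ?F; z \<in> space ?P\<rbrakk> \<Longrightarrow>
        (\<Sum>\<rho> | \<rho> permutes ?A. h J (z \<circ> \<rho>)) \<le> 2 * \<alpha>' * real (card {\<rho>. \<rho> permutes ?A})"
    for C :: "'w \<Rightarrow> 'y set" and f h
  proof -
    let ?B = "{\<omega> \<in> space M. f (I \<omega>) (U \<omega>) (?D \<omega>) \<le> \<alpha>'}"
    have bad: "Measurable.pred (borel \<Otimes>\<^sub>M ?P) (\<lambda>x. f J (fst x) (snd x) \<le> \<alpha>')" if "J \<in> ?F" for J
      using f[OF that] by measurable
    note * = randomized_exchangeable_prob_le[OF assms(1) finite_atLeastAtMost F exch D I_rv I_indep
        U_rv U_unif U_indep, of "\<lambda>J u z. f J u z \<le> \<alpha>'" h "2 * \<alpha>'", OF bad dom h _ sum]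
    have "?B \<in> events" "prob ?B \<le> 2 * \<alpha>'" using * a by auto
    moreover have "{\<omega> \<in> space M. snd (Z (n+1) \<omega>) \<in> C \<omega>} = space M - ?B"
      using C by (auto simp: not_le)
    ultimately show "1 - 2 * \<alpha>' \<le> prob {\<omega> \<in> space M. snd (Z (n+1) \<omega>) \<in> C \<omega>}"
      by (simp add: prob_compl)
  qed
  let ?X = "\<lambda>J z k. calibrator \<alpha>' (?p J z k)"
  let ?Ce = "\<lambda>\<omega>. e_mod_cross_set (space MY) s n K (I \<omega>) \<alpha>' (\<lambda>i. Z i \<omega>) (fst (Z (n+1) \<omega>))"
  let ?Cu = "\<lambda>\<omega>. u_mod_cross_set (space MY) s n K (I \<omega>) \<alpha>' (U \<omega>) (\<lambda>i. Z i \<omega>) (fst (Z (n+1) \<omega>))"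
  let ?Ceu = "\<lambda>\<omega>. eu_mod_cross_set (space MY) s n K (I \<omega>) \<alpha>' (U \<omega>) (\<lambda>i. Z i \<omega>) (fst (Z (n+1) \<omega>))"
  \<comment> \<open>The dummy argument \<open>u\<close> fits the nonrandomized set into the common
    scheme.\<close>
  let ?fe = "\<lambda>J (u::real) z. MIN l\<in>{1..K}. run_avg (?p J z) l"
  let ?fu = "\<lambda>J u z. 1 / (2 - u) * run_avg (?p J z) K"
  let ?feu = "\<lambda>J u z. min (1 / (2 - u) * ?p J z 1) (MIN l\<in>{1..K}. run_avg (?p J z) l)"
  let ?heu = "\<lambda>J z. run_avg (?X J z) (last_crossing K (?X J z))"
  have minD: "(MIN l\<in>{1..K}. run_avg (?p (I \<omega>) (?D \<omega>)) l) = (MIN l\<in>{1..K}. 1 / real l * (\<Sum>k=1..l.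
      cross_pvalue s n K (I \<omega>) (\<lambda>i. Z i \<omega>) (fst (Z (n+1) \<omega>)) k (snd (Z (n+1) \<omega>))))"
    if "\<omega> \<in> space M" for \<omega>
    using avgD[OF that] by (intro arg_cong[where f=Min] image_cong refl)
  have min_meas: "(\<lambda>x. ?fe J (fst x) (snd x)) \<in> borel_measurable (borel \<Otimes>\<^sub>M ?P)" if "J \<in> ?F" for J
    using avg_meas[OF that] by (intro borel_measurable_Min) auto
  have eu_meas: "(\<lambda>x. ?feu J (fst x) (snd x)) \<in> borel_measurable (borel \<Otimes>\<^sub>M ?P)" if "J \<in> ?F" for J
    using fst_meas p_meas[OF that, of 1] K
    by (intro borel_measurable_min min_meas[OF that] borel_measurable_times borel_measurable_divide
        borel_measurable_diff borel_measurable_const) auto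
  have u_meas: "(\<lambda>x. ?fu J (fst x) (snd x)) \<in> borel_measurable (borel \<Otimes>\<^sub>M ?P)" if "J \<in> ?F" for J
    using fst_meas avg_meas[OF that, of K] K
    by (intro borel_measurable_times borel_measurable_divide
        borel_measurable_diff borel_measurable_const) auto
  have eu_dom: "u \<le> ?heu J z" if "0 < u" "u < 1" "?feu J u z \<le> \<alpha>'" for J u z
    using u_le_run_avg_last_crossing[OF K(1) a that] .
  have heu: "0 \<le> ?heu J z" for J z by (intro run_avg_nonneg calibrator_nonneg)
  have heu_sum: "(\<Sum>\<rho> | \<rho> permutes ?A. ?heu J (z \<circ> \<rho>)) \<le> 2 * \<alpha>' * real (card {\<rho>. \<rho> permutes ?A})"
    if "J \<in> ?F" "z \<in> space ?P" for J z
    using sum_run_avg_last_crossing_test_pvalue_le[OF that(1) assms(9) K(2) m a spaceN[OF that(2)]] .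
  have cov: "1 - 2 * \<alpha>' \<le> prob {\<omega> \<in> space M. snd (Z (n+1) \<omega>) \<in> C \<omega>}"
    if exch: "exchangeable M ?N ?A Z" and C: "C \<in> {?Ce, ?Cu, ?Ceu}" for C
  proof -
    consider (e) "C = ?Ce" | (u) "C = ?Cu" | (eu) "C = ?Ceu" using C by blast
    then show ?thesis
    proof cases
      case e
      show ?thesis unfolding e
      proof (rule coverage[of ?Ce ?fe ?heu, OF exch])
        \<comment> \<open>Since \<open>?feu\<close> is at most \<open>?fe\<close>, failure of the
          e-set is failure of the eu-set at every \<open>u\<close>, and the same dominating average
          serves.\<close>
        show "u \<le> ?heu J z" if "J \<in> ?F" "0 < u" "u < 1" "?fe J u z \<le> \<alpha>'" for J u z
          using that by (intro eu_dom) (auto simp: min_le_iff_disj)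
      qed (use Y minD min_meas heu heu_sum in \<open>simp_all add: e_mod_cross_set_def\<close>)
    next
      case u
      show ?thesis unfolding u
      proof (rule coverage[of ?Cu ?fu "\<lambda>J z. run_avg (?X J z) K", OF exch])
        show "(\<Sum>\<rho> | \<rho> permutes ?A. run_avg (?X J (z \<circ> \<rho>)) K) \<le> 2 * \<alpha>' * real (card {\<rho>. \<rho> permutes ?A})"
          if "J \<in> ?F" "z \<in> space ?P" for J z
          using sum_run_avg_test_pvalue_le[OF that(1) assms(9) K(2) m a spaceN[OF that(2)]] .
        show "u \<le> run_avg (?X J z) K" if "J \<in> ?F" "0 < u" "u < 1" "?fu J u z \<le> \<alpha>'" for J u z
          using u_le_run_avg[OF K(1) a that(3,4)] .
        show "0 \<le> run_avg (?X J z) K" for J z by (intro run_avg_nonneg calibrator_nonneg)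
      qed (use Y avgD[of _ K] u_meas K in \<open>simp_all add: u_mod_cross_set_def\<close>)
    next
      case eu
      show ?thesis unfolding eu
      proof (rule coverage[of ?Ceu ?feu ?heu, OF exch])
        show "snd (Z (n+1) \<omega>) \<in> ?Ceu \<omega> \<longleftrightarrow> \<alpha>' < ?feu (I \<omega>) (U \<omega>) (?D \<omega>)" if "\<omega> \<in> space M" for \<omega>
          unfolding eu_mod_cross_set_def minD[OF that] using Y[OF that] pD[OF that, of 1] K by simp
      qed (use eu_meas heu heu_sum eu_dom in blast)+
    qed
  qed
  have subsets: "?Ce \<omega> \<subseteq> cross_set (space MY) s n K (I \<omega>) \<alpha> (\<lambda>i. Z i \<omega>) (fst (Z (n+1) \<omega>))"
      "?Cu \<omega> \<subseteq> cross_set (space MY) s n K (I \<omega>) \<alpha> (\<lambda>i. Z i \<omega>) (fst (Z (n+1) \<omega>))"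
      "?Ceu \<omega> \<subseteq> ?Ce \<omega>" if "\<omega> \<in> space M" for \<omega>
    using U_range[OF that] I_in[OF that] K(1) assms(4,7)
    by (intro e_mod_cross_set_subset u_mod_cross_set_subset eu_mod_cross_set_subset; simp)+
  show ?thesis
    unfolding Let_def by (intro conjI ballI impI subsets cov) assumption+
qed

end
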